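(* Suppose that $\{x\in\mathbb{R}^n:Ax=b\}$ is nonempty, that $f=h+g$ where $h:\mathbb{R}^n\to\mathbb{R}$ is differentiable with $\nabla h$ Lipschitz continuous with constant $L_h>0$, and $g:\mathbb{R}^n\to\mathbb{R}$ is proper, lower semicontinuous and $\rho_g$-weakly convex ($\rho_g>0$). Let $\eta\in(0,2)$ and $$0<\gamma<\frac{2}{(\rho_g+L_h)\left(1+\sqrt{1+\frac{2(2-\eta)\eta L_h^2}{(\rho_g+L_h)^2}}\right)}.$$ Let $\{(x^k,z^k,\lambda^k)\}$ be a sequence generated by LiMEAL (defined in the context). Then the following hold. (a) Use a fixed penalty parameter $\beta_k=\beta$ for all $k$, with $\beta$ sufficiently large such that $\alpha:=\frac{2\beta+\gamma\eta(1-\eta/2)}{2c_{\gamma,A}\beta^2}$ satisfies $$\alpha<\min\left\{\frac{1}{12\gamma}\Big(\frac2\eta-1\Big),\ \frac{1-\gamma(\rho_g+L_h)-\eta(1-\eta/2)\gamma^2L_h^2}{6\gamma\left((1+\gamma L_g)^2+\gamma^2L_h^2\right)}\right\}.$$ If $g$ has the implicit Lipschitz subgradient property with constant $L_g>0$ (possibly depending on $\gamma$) and $\{\mathcal{E}^k_{\mathrm{limeal}}\}_{k\ge1}$ is lower bounded, then $\xi^k_{\mathrm{limeal}}=o(1/\sqrt{k})$. (b) Pick $K\ge1$. Set $\{\beta_k\}$ such that $\alpha_k\equiv\frac{\bar\alpha^*}{K}$ for some positive constant $$\bar\alpha^*\le\min\left\{\frac{1-\gamma(\rho_g+L_h)-\eta(1-\eta/2)\gamma^2L_h^2}{8\gamma(1+\gamma^2L_h^2)},\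 \frac{1}{16\gamma}\Big(\frac2\eta-1\Big)\right\}.$$ If $g$ has the implicit bounded subgradient property with constant $\hat L_g>0$ (possibly depending on $\gamma$) and $\{\tilde{\mathcal{E}}^k_{\mathrm{limeal}}\}_{k\ge1}$ is lower bounded, then $\xi^K_{\mathrm{limeal}}\le\tilde c_3/\sqrt{K}$ for some constant $\tilde c_3>0$.
   Context: The problem is to minimize $f(x)=h(x)+g(x)$ over $x\in\mathbb{R}^n$ subject to $Ax=b$, with $A\in\mathbb{R}^{m\times n}$, $b\in\mathbb{R}^m$. $\|\cdot\|$ is the Euclidean norm. A function $q$ is $\rho$-weakly convex ($\rho>0$) if $q+\frac{\rho}{2}\|\cdot\|^2$ is convex. Moreau envelope and prox: $\mathcal{M}_{\gamma,q}(z)=\min_x\{q(x)+\frac1{2\gamma}\|x-z\|^2\}$, $\mathrm{Prox}_{\gamma,q}(z)=\operatorname{argmin}_x\{q(x)+\frac1{2\gamma}\|x-z\|^2\}$. If $q$ is proper, lower semicontinuous, $\rho$-weakly convex and $\gamma\in(0,\rho^{-1})$, the prox is single-valued and $\mathcal{M}_{\gamma,q}$ is differentiable with $\nabla\mathcal{M}_{\gamma,q}(z)=\gamma^{-1}(z-\mathrm{Prox}_{\gamma,q}(z))$. For $x\in\mathrm{ran}(\mathrm{Prox}_{\gamma,q})$ let $\mathrm{Prox}_{\gamma,q}^{-1}(x)=\{w:\mathrm{Prox}_{\gamma,q}(w)=x\}$. Implicit Lipschitz subgradient property of a $\rho$-weakly convex $q$: for any $\gamma\in(0,\rho^{-1})$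 there is $L>0$ (depending on $\gamma$) such that for all $u,v\in\mathrm{ran}(\mathrm{Prox}_{\gamma,q})$, all $w\in\mathrm{Prox}_{\gamma,q}^{-1}(u)$ and $w'\in\mathrm{Prox}_{\gamma,q}^{-1}(v)$: $\|\nabla\mathcal{M}_{\gamma,q}(w)-\nabla\mathcal{M}_{\gamma,q}(w')\|\le L\|u-v\|$. Implicit bounded subgradient property of $q$: for any $\gamma\in(0,\rho^{-1})$ there is $\hat L>0$ (depending on $\gamma$) such that for all $u\in\mathrm{ran}(\mathrm{Prox}_{\gamma,q})$ and $w\in\mathrm{Prox}_{\gamma,q}^{-1}(u)$: $\|\nabla\mathcal{M}_{\gamma,q}(w)\|\le\hat L$. For $\beta>0$: $\mathcal{L}_\beta(x,\lambda)=f(x)+\langle\lambda,Ax-b\rangle+\frac\beta2\|Ax-b\|^2$ and $\mathcal{P}_\beta(x,z,\lambda)=\mathcal{L}_\beta(x,\lambda)+\frac1{2\gamma}\|x-z\|^2$. LiMEAL: given $(x^0,z^0,\lambda^0)$, $\gamma>0$, $\eta\in(0,2)$ and penalty parameters $\beta_k>0$, put $f^k(x)=h(x^k)+\langle\nabla h(x^k),x-x^k\rangle+g(x)$ and, for $k=0,1,\dots$: $x^{k+1}=\operatorname{argmin}_x\{f^k(x)+\langle\lambda^k,Ax-b\rangle+\frac{\beta_k}2\|Ax-b\|^2+\frac1{2\gamma}\|x-z^k\|^2\}$, $z^{k+1}=z^k-\eta(z^k-x^{k+1})$, $\lambda^{k+1}=\lambda^k+\beta_k(Ax^{k+1}-b)$.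 Stationarity measure: $g^k_{\mathrm{limeal}}=\big(\gamma^{-1}(z^k-x^{k+1})+\nabla h(x^{k+1})-\nabla h(x^k),\ \beta_k^{-1}(\lambda^{k+1}-\lambda^k)\big)\in\mathbb{R}^n\times\mathbb{R}^m$ and $\xi^k_{\mathrm{limeal}}=\min_{0\le t\le k}\|g^t_{\mathrm{limeal}}\|$. Let $c_{\gamma,A}=\gamma^2\tilde\sigma_{\min}(A^TA)$, where $\tilde\sigma_{\min}(A^TA)$ is the smallest positive eigenvalue of $A^TA$, and $\alpha_k=\frac{\beta_k+\beta_{k+1}+\gamma\eta(1-\eta/2)}{2c_{\gamma,A}\beta_k^2}$ (so $\alpha_k=\alpha$ when $\beta_k\equiv\beta$). For $k\ge1$: $\mathcal{E}^k_{\mathrm{limeal}}=\mathcal{P}_{\beta_k}(x^k,z^k,\lambda^k)+3\alpha_k(\gamma^2L_h^2\|x^k-x^{k-1}\|^2+\|z^k-z^{k-1}\|^2)$, and $\tilde{\mathcal{E}}^k_{\mathrm{limeal}}=\mathcal{P}_{\beta_k}(x^k,z^k,\lambda^k)+4\alpha_k(\gamma^2L_h^2\|x^k-x^{k-1}\|^2+\|z^k-z^{k-1}\|^2)$. *)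

theory Defs
  imports "HOL-Analysis.Analysis" "HOL-Library.Landau_Symbols"
begin

section \<open>Weak convexity, proximal mapping, Moreau envelope\<close>

definition grad :: "('a::real_inner \<Rightarrow> real) \<Rightarrow> 'a \<Rightarrow> 'a" where
  "grad q x = (THE D. GDERIV q x :> D)"

definition weakly_convex :: "real \<Rightarrow> ('a::real_inner \<Rightarrow> real) \<Rightarrow> bool" where
  "weakly_convex \<rho> q \<longleftrightarrow> 0 < \<rho> \<and> convex_on UNIV (\<lambda>x. q x + \<rho> / 2 * (norm x)\<^sup>2)"

text \<open>Properness has no counterpart below: every function here is real-valued, hence proper.\<close>

definition lower_semicont :: "('a::topological_space \<Rightarrow> real) \<Rightarrow> bool" where
  "lower_semicont q \<longleftrightarrow> (\<forall>x. \<forall>a < q x. eventually (\<lambda>y. a < q y) (nhds x))"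

definition moreau :: "real \<Rightarrow> ('a::real_inner \<Rightarrow> real) \<Rightarrow> 'a \<Rightarrow> real" where
  "moreau \<gamma> q z = (INF x. q x + 1 / (2 * \<gamma>) * (norm (x - z))\<^sup>2)"

text \<open>
  The choice made by \<^const>\<open>arg_min\<close> is immaterial where \<open>prox\<close> is used: for lower
  semicontinuous \<open>\<rho>\<close>-weakly convex \<open>q\<close> and \<open>0 < \<gamma> < 1 / \<rho>\<close> there is exactly one minimiser,
  and the infimum in \<open>moreau\<close> is attained at it.
\<close>

definition prox :: "real \<Rightarrow> ('a::real_inner \<Rightarrow> real) \<Rightarrow> 'a \<Rightarrow> 'a" where
  "prox \<gamma> q z = arg_min (\<lambda>x. q x + 1 / (2 * \<gamma>) * (norm (x - z))\<^sup>2) (\<lambda>_. True)"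

text \<open>The constants are functions \<open>L\<close>, \<open>M\<close> of the proximal parameter \<open>\<gamma>\<close>.\<close>

definition implicit_lipschitz_subgradient ::
  "real \<Rightarrow> ('a::real_inner \<Rightarrow> real) \<Rightarrow> (real \<Rightarrow> real) \<Rightarrow> bool" where
  "implicit_lipschitz_subgradient \<rho> q L \<longleftrightarrow>
     (\<forall>\<gamma>. 0 < \<gamma> \<and> \<gamma> < 1 / \<rho> \<longrightarrow> 0 < L \<gamma> \<and>
        (\<forall>u \<in> range (prox \<gamma> q). \<forall>v \<in> range (prox \<gamma> q).
         \<forall>w \<in> prox \<gamma> q -` {u}. \<forall>w' \<in> prox \<gamma> q -` {v}.
           norm (grad (moreau \<gamma> q) w - grad (moreau \<gamma> q) w') \<le> L \<gamma> * norm (u - v)))"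

definition implicit_bounded_subgradient ::
  "real \<Rightarrow> ('a::real_inner \<Rightarrow> real) \<Rightarrow> (real \<Rightarrow> real) \<Rightarrow> bool" where
  "implicit_bounded_subgradient \<rho> q M \<longleftrightarrow>
     (\<forall>\<gamma>. 0 < \<gamma> \<and> \<gamma> < 1 / \<rho> \<longrightarrow> 0 < M \<gamma> \<and>
        (\<forall>u \<in> range (prox \<gamma> q). \<forall>w \<in> prox \<gamma> q -` {u}.
           norm (grad (moreau \<gamma> q) w) \<le> M \<gamma>))"


section \<open>The linearised Moreau envelope augmented Lagrangian method\<close>

definition aug_lagrangian ::
  "(real^'n \<Rightarrow> real) \<Rightarrow> real^'n^'m \<Rightarrow> real^'m \<Rightarrow> real \<Rightarrow> real^'n \<Rightarrow> real^'m \<Rightarrow> real" where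
  "aug_lagrangian f A b \<beta> x l = f x + l \<bullet> (A *v x - b) + \<beta> / 2 * (norm (A *v x - b))\<^sup>2"

definition prox_aug_lagrangian ::
  "(real^'n \<Rightarrow> real) \<Rightarrow> real^'n^'m \<Rightarrow> real^'m \<Rightarrow> real \<Rightarrow> real \<Rightarrow>
   real^'n \<Rightarrow> real^'n \<Rightarrow> real^'m \<Rightarrow> real" where
  "prox_aug_lagrangian f A b \<gamma> \<beta> x z l =
     aug_lagrangian f A b \<beta> x l + 1 / (2 * \<gamma>) * (norm (x - z))\<^sup>2"

definition linearised ::
  "('a::real_inner \<Rightarrow> real) \<Rightarrow> ('a \<Rightarrow> real) \<Rightarrow> 'a \<Rightarrow> 'a \<Rightarrow> real" where
  "linearised h g y x = h y + grad h y \<bullet> (x - y) + g x"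

definition limeal ::
  "(real^'n \<Rightarrow> real) \<Rightarrow> (real^'n \<Rightarrow> real) \<Rightarrow> real^'n^'m \<Rightarrow> real^'m \<Rightarrow> real \<Rightarrow> real \<Rightarrow>
   (nat \<Rightarrow> real) \<Rightarrow> (nat \<Rightarrow> real^'n) \<Rightarrow> (nat \<Rightarrow> real^'n) \<Rightarrow> (nat \<Rightarrow> real^'m) \<Rightarrow> bool" where
  "limeal h g A b \<gamma> \<eta> \<beta> x z l \<longleftrightarrow>
     (\<forall>k. 0 < \<beta> k \<and>
          is_arg_min (\<lambda>y. prox_aug_lagrangian (linearised h g (x k)) A b \<gamma> (\<beta> k) y (z k) (l k))
            (\<lambda>_. True) (x (Suc k)) \<and>
          z (Suc k) = z k - \<eta> *\<^sub>R (z k - x (Suc k)) \<and>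
          l (Suc k) = l k + \<beta> k *\<^sub>R (A *v x (Suc k) - b))"

text \<open>The product type carries the Euclidean norm.\<close>

definition limeal_residual ::
  "(real^'n \<Rightarrow> real) \<Rightarrow> real \<Rightarrow> (nat \<Rightarrow> real) \<Rightarrow>
   (nat \<Rightarrow> real^'n) \<Rightarrow> (nat \<Rightarrow> real^'n) \<Rightarrow> (nat \<Rightarrow> real^'m) \<Rightarrow> nat \<Rightarrow> (real^'n) \<times> (real^'m)" where
  "limeal_residual h \<gamma> \<beta> x z l k =
     ((1 / \<gamma>) *\<^sub>R (z k - x (Suc k)) + grad h (x (Suc k)) - grad h (x k),
      (1 / \<beta> k) *\<^sub>R (l (Suc k) - l k))"

definition limeal_xi ::
  "(real^'n \<Rightarrow> real) \<Rightarrow> real \<Rightarrow> (nat \<Rightarrow> real) \<Rightarrow>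
   (nat \<Rightarrow> real^'n) \<Rightarrow> (nat \<Rightarrow> real^'n) \<Rightarrow> (nat \<Rightarrow> real^'m) \<Rightarrow> nat \<Rightarrow> real" where
  "limeal_xi h \<gamma> \<beta> x z l k = Min ((\<lambda>t. norm (limeal_residual h \<gamma> \<beta> x z l t)) ` {0..k})"

text \<open>
  The smallest positive eigenvalue of \<open>B\<close>. For \<open>B = transpose A ** A\<close> it exists unless
  \<open>A = 0\<close>, in which case the value is unspecified.
\<close>

definition min_pos_eigenvalue :: "real^'n^'n \<Rightarrow> real" where
  "min_pos_eigenvalue B = (LEAST \<mu>. 0 < \<mu> \<and> (\<exists>v. v \<noteq> 0 \<and> B *v v = \<mu> *\<^sub>R v))"

definition c_const :: "real \<Rightarrow> real^'n^'m \<Rightarrow> real" where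
  "c_const \<gamma> A = \<gamma>\<^sup>2 * min_pos_eigenvalue (transpose A ** A)"

definition limeal_alpha :: "real^'n^'m \<Rightarrow> real \<Rightarrow> real \<Rightarrow> (nat \<Rightarrow> real) \<Rightarrow> nat \<Rightarrow> real" where
  "limeal_alpha A \<gamma> \<eta> \<beta> k =
     (\<beta> k + \<beta> (Suc k) + \<gamma> * \<eta> * (1 - \<eta> / 2)) / (2 * c_const \<gamma> A * (\<beta> k)\<^sup>2)"

text \<open>
  \<open>limeal_energy 3\<close> and \<open>limeal_energy 4\<close> are the two Lyapunov sequences, for the Lipschitz and the
  bounded case respectively. Both are only meant for indices \<open>k \<ge> 1\<close>.
\<close>

definition limeal_energy ::
  "real \<Rightarrow> (real^'n \<Rightarrow> real) \<Rightarrow> (real^'n \<Rightarrow> real) \<Rightarrow> real^'n^'m \<Rightarrow> real^'m \<Rightarrow>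
   real \<Rightarrow> real \<Rightarrow> real \<Rightarrow> (nat \<Rightarrow> real) \<Rightarrow>
   (nat \<Rightarrow> real^'n) \<Rightarrow> (nat \<Rightarrow> real^'n) \<Rightarrow> (nat \<Rightarrow> real^'m) \<Rightarrow> nat \<Rightarrow> real" where
  "limeal_energy c h g A b L\<^sub>h \<gamma> \<eta> \<beta> x z l k =
     prox_aug_lagrangian (\<lambda>y. h y + g y) A b \<gamma> (\<beta> k) (x k) (z k) (l k) +
     c * limeal_alpha A \<gamma> \<eta> \<beta> k *
       (\<gamma>\<^sup>2 * L\<^sub>h\<^sup>2 * (norm (x k - x (k - 1)))\<^sup>2 + (norm (z k - z (k - 1)))\<^sup>2)"

end

theory Submission
  imports Defs
begin

text \<open>
  Both rates come from an energy that decreases at every iteration by at least a fixed multiple of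
  the squared stationarity residual, up to a small error in the bounded case.

  One iteration changes the proximal augmented Lagrangian \<open>\<P>\<close> in three ways. The proximal step lowers
  it by a multiple of \<open>\<parallel>x\<^sup>k\<^sup>+\<^sup>1 - x\<^sup>k\<parallel>\<^sup>2\<close>, because the subproblem is strongly convex and linearising \<open>h\<close>
  costs at most \<open>L\<^sub>h / 2\<close> times that square (the bound on \<open>\<gamma>\<close> keeps the net
  coefficient positive, with a margin that pays for the gradient difference in the residual); moving
  the centre lowers it by a multiple of \<open>\<parallel>z\<^sup>k\<^sup>+\<^sup>1 - z\<^sup>k\<parallel>\<^sup>2\<close>; the dual step and the change of penalty raise it by a multiple of
  \<open>\<parallel>\<lambda>\<^sup>k\<^sup>+\<^sup>1 - \<lambda>\<^sup>k\<parallel>\<^sup>2\<close> (\<open>merit_descent\<close>). To control this last term, note that dual steps lie in the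
  range of \<open>A\<close>, where \<open>\<parallel>A\<^sup>T w\<parallel>\<^sup>2\<close> is at least the smallest positive eigenvalue of \<open>A\<^sup>T A\<close> times
  \<open>\<parallel>w\<parallel>\<^sup>2\<close> (\<open>min_pos_eigenvalue_lower_bound\<close>), and that the optimality condition of the subproblem
  writes \<open>A\<^sup>T \<lambda>\<^sup>k\<^sup>+\<^sup>1\<close> as \<open>- \<nabla>h(x\<^sup>k) - s\<^sup>k - (x\<^sup>k\<^sup>+\<^sup>1 - z\<^sup>k) / \<gamma>\<close> with a subgradient \<open>s\<^sup>k\<close> of \<open>g\<close> at
  \<open>x\<^sup>k\<^sup>+\<^sup>1\<close>. Hence the dual step is bounded by the primal steps of two consecutive iterations and by
  \<open>\<parallel>s\<^sup>k - s\<^sup>k\<^sup>-\<^sup>1\<parallel>\<close>. The steps of the earlier iteration are the reason for the additional term of the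
  energy (\<open>energy_descent\<close>).

  The implicit subgradient properties bound \<open>\<parallel>s\<^sup>k - s\<^sup>k\<^sup>-\<^sup>1\<parallel>\<close>. They speak about gradients of the Moreau
  envelope, and every subgradient \<open>s\<close> of \<open>g\<close> at \<open>p\<close> is such a gradient, namely at \<open>p + \<gamma> s\<close>, whose
  proximal point is \<open>p\<close> (\<open>prox_eq_of_weak_subgradient\<close>, \<open>GDERIV_moreau\<close>).

  In the Lipschitz case the difference of subgradients is absorbed by the primal step, the squared
  residuals are summable, and the running minimum of a square summable sequence is \<open>o(1 / \<surd>k)\<close>. In
  the bounded case each iteration leaves an error proportional to \<open>\<alpha>\<^sub>k = \<alpha> / K\<close>, so the squared
  residuals of the first \<open>K\<close> iterations have a sum bounded independently of \<open>K\<close>. For the constant to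
  be uniform over all admissible penalties, the initial energy must be bounded by the initial data
  alone although \<open>\<beta>\<^sub>0\<close> and \<open>\<beta>\<^sub>1\<close> may be arbitrarily large; this is \<open>first_energy_le\<close>.
\<close>

section \<open>Gradients\<close>

lemma GDERIV_unique:
  fixes q :: "'a::euclidean_space \<Rightarrow> real"
  assumes "GDERIV q x :> D" and "GDERIV q x :> D'"
  shows "D = D'"
proof -
  have "(\<lambda>h. h \<bullet> D) = (\<lambda>h. h \<bullet> D')"
    using assms unfolding gderiv_def by (rule has_derivative_unique)
  then show ?thesis
    by (metis vector_eq_ldot)
qed

lemma grad_eq:
  fixes q :: "'a::euclidean_space \<Rightarrow> real"
  assumes "GDERIV q x :> D"
  shows "grad q x = D"
  unfolding grad_def using assms GDERIV_unique by blast

lemma GDERIV_grad: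
  fixes q :: "'a::euclidean_space \<Rightarrow> real"
  assumes "q differentiable (at x)"
  shows "GDERIV q x :> grad q x"
proof -
  obtain q' where q': "(q has_derivative q') (at x)"
    using assms unfolding differentiable_def by blast
  then interpret bounded_linear q'
    by (rule has_derivative_bounded_linear)
  have "h \<bullet> adjoint q' 1 = q' h" for h
    using adjoint_works[of q' h 1] linear_axioms by simp
  with q' have "GDERIV q x :> adjoint q' 1"
    unfolding gderiv_def by simp
  then show ?thesis
    using grad_eq by metis
qed

lemma GDERIV_along_line:
  fixes q :: "'a::euclidean_space \<Rightarrow> real"
  assumes "GDERIV q (p + t *\<^sub>R d) :> D"
  shows "DERIV (\<lambda>t. q (p + t *\<^sub>R d)) t :> D \<bullet> d"
proof -
  have line: "((\<lambda>t. p + t *\<^sub>R d) has_derivative (\<lambda>s. s *\<^sub>R d)) (at t)"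
    by (auto intro!: derivative_eq_intros)
  have "((\<lambda>t. q (p + t *\<^sub>R d)) has_derivative (\<lambda>s. (s *\<^sub>R d) \<bullet> D)) (at t)"
    using has_derivative_compose[OF line assms[unfolded gderiv_def]] .
  then show ?thesis
    by (simp add: has_field_derivative_def inner_commute mult_commute_abs)
qed

text \<open>
  The difference of the two sides is monotone along the segment from \<open>u\<close> to \<open>v\<close>: its derivative at
  parameter \<open>t\<close> compares gradients at points of distance \<open>t \<parallel>v - u\<parallel>\<close>.
\<close>

lemma lipschitz_gradient_upper_bound:
  fixes h :: "'a::euclidean_space \<Rightarrow> real"
  assumes grad: "\<And>u. GDERIV h u :> grad h u"
    and lip: "\<And>u v. norm (grad h u - grad h v) \<le> L * norm (u - v)"
  shows "h v \<le> h u + grad h u \<bullet> (v - u) + L / 2 * (norm (v - u))\<^sup>2"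
proof -
  define d where "d = v - u"
  define \<phi> where "\<phi> t = h (u + t *\<^sub>R d) - t * (grad h u \<bullet> d) - L / 2 * t\<^sup>2 * (norm d)\<^sup>2" for t
  have "\<phi> 1 \<le> \<phi> 0"
  proof (rule DERIV_nonpos_imp_nonincreasing[of 0 1 \<phi>])
    fix t :: real
    assume t: "0 \<le> t" "t \<le> 1"
    let ?D = "grad h (u + t *\<^sub>R d) \<bullet> d - grad h u \<bullet> d - L * t * (norm d)\<^sup>2"
    have "DERIV \<phi> t :> ?D"
      unfolding \<phi>_def
      by (rule derivative_eq_intros GDERIV_along_line[OF grad] refl | simp)+
    moreover have "(grad h (u + t *\<^sub>R d) - grad h u) \<bullet> d
        \<le> norm (grad h (u + t *\<^sub>R d) - grad h u) * norm d"
      by (rule norm_cauchy_schwarz)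
    moreover have "norm (grad h (u + t *\<^sub>R d) - grad h u) * norm d \<le> (L * (t * norm d)) * norm d"
      using lip[of "u + t *\<^sub>R d" u] t by (intro mult_right_mono) auto
    ultimately show "\<exists>y. DERIV \<phi> t :> y \<and> y \<le> 0"
      by (intro exI[of _ ?D]) (simp add: inner_diff_left power2_eq_square algebra_simps)
  qed simp
  then show ?thesis
    by (simp add: \<phi>_def d_def)
qed

section \<open>Subgradients of weakly convex functions\<close>

text \<open>
  For a \<open>\<rho>\<close>-weakly convex function these are the regular subgradients; the inequality is global,
  which makes it possible to argue without any local analysis of \<open>q\<close>.
\<close>

definition weak_subgradient :: "real \<Rightarrow> ('a::real_inner \<Rightarrow> real) \<Rightarrow> 'a \<Rightarrow> 'a \<Rightarrow> bool" where
  "weak_subgradient \<rho> q p s \<longleftrightarrow> (\<forall>y. q p + s \<bullet> (y - p) - \<rho> / 2 * (norm (y - p))\<^sup>2 \<le> q y)"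

lemma weak_subgradientD:
  "weak_subgradient \<rho> q p s \<Longrightarrow> q p + s \<bullet> (y - p) - \<rho> / 2 * (norm (y - p))\<^sup>2 \<le> q y"
  by (simp add: weak_subgradient_def)

lemma weakly_convex_segment:
  assumes "weakly_convex \<rho> q" and "0 \<le> t" and "t \<le> 1"
  shows "q (p + t *\<^sub>R (y - p))
    \<le> (1 - t) * q p + t * q y + \<rho> / 2 * (t * (1 - t)) * (norm (y - p))\<^sup>2"
proof -
  have "convex_on UNIV (\<lambda>x. q x + \<rho> / 2 * (norm x)\<^sup>2)"
    using assms(1) by (simp add: weakly_convex_def)
  then have "q ((1 - t) *\<^sub>R p + t *\<^sub>R y) + \<rho> / 2 * (norm ((1 - t) *\<^sub>R p + t *\<^sub>R y))\<^sup>2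
      \<le> (1 - t) * (q p + \<rho> / 2 * (norm p)\<^sup>2) + t * (q y + \<rho> / 2 * (norm y)\<^sup>2)"
    using assms(2,3) by (rule convex_onD) auto
  moreover have "(1 - t) *\<^sub>R p + t *\<^sub>R y = p + t *\<^sub>R (y - p)"
    by (simp add: algebra_simps)
  moreover have "(norm ((1 - t) *\<^sub>R p + t *\<^sub>R y))\<^sup>2
      = (1 - t) * (norm p)\<^sup>2 + t * (norm y)\<^sup>2 - t * (1 - t) * (norm (y - p))\<^sup>2"
    unfolding power2_norm_eq_inner
    by (simp add: inner_simps inner_commute[of y p] algebra_simps power2_eq_square)
  ultimately have "q (p + t *\<^sub>R (y - p))
      + \<rho> / 2 * ((1 - t) * (norm p)\<^sup>2 + t * (norm y)\<^sup>2 - t * (1 - t) * (norm (y - p))\<^sup>2)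
    \<le> (1 - t) * (q p + \<rho> / 2 * (norm p)\<^sup>2) + t * (q y + \<rho> / 2 * (norm y)\<^sup>2)"
    by simp
  then show ?thesis
    by (simp add: field_simps)
qed

text \<open>
  Fermat's rule. Comparing the minimiser \<open>p\<close> with a point at distance \<open>t\<close> along the segment to
  \<open>y\<close> and dividing by \<open>t\<close>, the limit \<open>t \<rightarrow> 0\<close> replaces \<open>\<psi>\<close> by its slope at \<open>p\<close>, while weak
  convexity keeps a global lower bound on \<open>q y\<close>.
\<close>

lemma weak_subgradient_of_minimiser:
  fixes q :: "'a::euclidean_space \<Rightarrow> real"
  assumes wc: "weakly_convex \<rho> q"
    and min: "\<And>y. q p + \<psi> p \<le> q y + \<psi> y"
    and grad: "GDERIV \<psi> p :> D"
  shows "weak_subgradient \<rho> q p (- D)"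
  unfolding weak_subgradient_def
proof
  fix y
  define d where "d = y - p"
  define slope where "slope t = (\<psi> (p + t *\<^sub>R d) - \<psi> p) / t" for t
  have "DERIV (\<lambda>t. \<psi> (p + t *\<^sub>R d)) 0 :> D \<bullet> d"
    by (rule GDERIV_along_line) (simp add: grad)
  then have "(slope \<longlongrightarrow> D \<bullet> d) (at 0)"
    by (simp add: DERIV_def slope_def[abs_def])
  then have "(slope \<longlongrightarrow> D \<bullet> d) (at_right 0)"
    by (rule filterlim_mono) (auto simp: at_le)
  then have lim: "((\<lambda>t. q y - q p + \<rho> / 2 * (1 - t) * (norm d)\<^sup>2 + slope t)
      \<longlongrightarrow> q y - q p + \<rho> / 2 * (1 - 0) * (norm d)\<^sup>2 + D \<bullet> d) (at_right 0)"
    by (intro tendsto_intros)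
  have "\<forall>\<^sub>F t in at_right 0. 0 \<le> q y - q p + \<rho> / 2 * (1 - t) * (norm d)\<^sup>2 + slope t"
    unfolding eventually_at_right_field
  proof (intro exI[of _ 1] conjI allI impI)
    fix t :: real
    assume t: "0 < t" "t < 1"
    have "t * slope t = \<psi> (p + t *\<^sub>R d) - \<psi> p"
      using t by (simp add: slope_def)
    with weakly_convex_segment[OF wc, of t p y] min[of "p + t *\<^sub>R d"] t
    have "0 \<le> t * (q y - q p + \<rho> / 2 * (1 - t) * (norm d)\<^sup>2 + slope t)"
      by (simp add: d_def algebra_simps)
    with t show "0 \<le> q y - q p + \<rho> / 2 * (1 - t) * (norm d)\<^sup>2 + slope t"
      by (simp add: zero_le_mult_iff)
  qed simp
  from tendsto_lowerbound[OF lim this]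
  show "q p + - D \<bullet> (y - p) - \<rho> / 2 * (norm (y - p))\<^sup>2 \<le> q y"
    by (simp add: d_def)
qed

text \<open>
  Completing the square: the proximal objective centred at \<open>p + \<gamma> s + d\<close> lies above a parabola in
  \<open>y - p\<close> of curvature \<open>1 / \<gamma> - \<rho>\<close>. With \<open>d = 0\<close> this makes \<open>p\<close> the unique proximal point, and for
  small \<open>d\<close> it is the lower half of the differentiability of the envelope.
\<close>

lemma prox_objective_lower_bound:
  assumes "weak_subgradient \<rho> q p s" and "0 < \<gamma>"
  shows "q p + \<gamma> / 2 * (norm s)\<^sup>2 + s \<bullet> d + (norm d)\<^sup>2 / (2 * \<gamma>)
      + (1 / \<gamma> - \<rho>) / 2 * (norm (y - p))\<^sup>2 - (y - p) \<bullet> d / \<gamma>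
    \<le> q y + 1 / (2 * \<gamma>) * (norm (y - (p + \<gamma> *\<^sub>R s + d)))\<^sup>2"
proof -
  define e where "e = y - p"
  have shift: "y - (p + \<gamma> *\<^sub>R s + d) = e - \<gamma> *\<^sub>R s - d"
    by (simp add: e_def)
  have "1 / (2 * \<gamma>) * (norm (e - \<gamma> *\<^sub>R s - d))\<^sup>2 = (norm e)\<^sup>2 / (2 * \<gamma>)
      + \<gamma> / 2 * (norm s)\<^sup>2 + (norm d)\<^sup>2 / (2 * \<gamma>) - s \<bullet> e - e \<bullet> d / \<gamma> + s \<bullet> d"
    using assms(2) unfolding power2_norm_eq_inner
    by (simp add: inner_simps inner_commute field_simps power2_eq_square)
  moreover have "(1 / \<gamma> - \<rho>) / 2 * (norm e)\<^sup>2 = (norm e)\<^sup>2 / (2 * \<gamma>) - \<rho> / 2 * (norm e)\<^sup>2"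
    by (simp add: algebra_simps diff_divide_distrib)
  ultimately show ?thesis
    using weak_subgradientD[OF assms(1), of y]
    unfolding shift e_def[symmetric] by linarith
qed

lemma prox_eq_of_weak_subgradient:
  assumes sub: "weak_subgradient \<rho> q p s" and \<gamma>: "0 < \<gamma>" "\<gamma> * \<rho> < 1"
  shows "prox \<gamma> q (p + \<gamma> *\<^sub>R s) = p"
proof -
  let ?\<Phi> = "\<lambda>y. q y + 1 / (2 * \<gamma>) * (norm (y - (p + \<gamma> *\<^sub>R s)))\<^sup>2"
  have at_p: "?\<Phi> p = q p + \<gamma> / 2 * (norm s)\<^sup>2"
    using \<gamma> by (simp add: power_mult_distrib power2_eq_square)
  have growth: "?\<Phi> p + (1 / \<gamma> - \<rho>) / 2 * (norm (y - p))\<^sup>2 \<le> ?\<Phi> y" for y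
    using prox_objective_lower_bound[OF sub \<gamma>(1), of 0 y] at_p by simp
  have pos: "0 < (1 / \<gamma> - \<rho>) / 2"
    using \<gamma> by (simp add: field_simps)
  show ?thesis
    unfolding prox_def
  proof (rule arg_minI)
    fix y
    have "0 \<le> (1 / \<gamma> - \<rho>) / 2 * (norm (y - p))\<^sup>2"
      using pos by (intro mult_nonneg_nonneg) auto
    then show "\<not> ?\<Phi> y < ?\<Phi> p"
      using growth[of y] by linarith
  next
    fix y
    assume "\<forall>y'. True \<longrightarrow> \<not> ?\<Phi> y' < ?\<Phi> y"
    then have "?\<Phi> y \<le> ?\<Phi> p"
      using linorder_not_less by blast
    then have "(1 / \<gamma> - \<rho>) / 2 * (norm (y - p))\<^sup>2 \<le> 0"
      using growth[of y] by linarith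
    with pos show "y = p"
      by (simp add: mult_le_0_iff)
  qed simp
qed

text \<open>
  The envelope is squeezed between two parabolas touching at \<open>p + \<gamma> s\<close>: above by the objective at
  the fixed point \<open>p\<close>, below by the previous bound minimised over \<open>y\<close>. Both have slope \<open>s\<close> there.
\<close>

lemma GDERIV_moreau:
  fixes q :: "'a::euclidean_space \<Rightarrow> real"
  assumes sub: "weak_subgradient \<rho> q p s" and \<gamma>: "0 < \<gamma>" "\<gamma> * \<rho> < 1"
  shows "GDERIV (moreau \<gamma> q) (p + \<gamma> *\<^sub>R s) :> s"
proof -
  define w where "w = p + \<gamma> *\<^sub>R s"
  define m where "m = 1 / \<gamma> - \<rho>"
  define V where "V = q p + \<gamma> / 2 * (norm s)\<^sup>2"
  define C where "C = max (1 / (2 * \<gamma>)) (1 / (2 * \<gamma>\<^sup>2 * m))"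
  have m: "0 < m"
    using \<gamma> by (simp add: m_def field_simps)
  have lower: "V + s \<bullet> d - C * (norm d)\<^sup>2 \<le> q y + 1 / (2 * \<gamma>) * (norm (y - (w + d)))\<^sup>2" for y d
  proof -
    have "(y - p) \<bullet> d \<le> norm (y - p) * norm d"
      by (rule norm_cauchy_schwarz)
    then have "(y - p) \<bullet> d / \<gamma> \<le> norm (y - p) * (norm d / \<gamma>)"
      using \<gamma> by (simp add: field_simps)
    \<comment> \<open>Young's inequality with the weight that uses up the curvature \<open>m\<close>.\<close>
    moreover have "0 \<le> (m * norm (y - p) - norm d / \<gamma>)\<^sup>2 / (2 * m)"
      using m by simp
    then have "0 \<le> m / 2 * (norm (y - p))\<^sup>2 - norm (y - p) * (norm d / \<gamma>) + (norm d)\<^sup>2 / (2 * \<gamma>\<^sup>2 * m)"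
      using m \<gamma> by (simp add: power2_diff field_simps power2_eq_square)
    moreover have "(norm d)\<^sup>2 / (2 * \<gamma>\<^sup>2 * m) \<le> C * (norm d)\<^sup>2"
      using mult_right_mono[of "1 / (2 * \<gamma>\<^sup>2 * m)" C "(norm d)\<^sup>2"] by (simp add: C_def)
    moreover have "0 \<le> (norm d)\<^sup>2 / (2 * \<gamma>)"
      using \<gamma> by simp
    ultimately show ?thesis
      using prox_objective_lower_bound[OF sub \<gamma>(1), of d y]
      unfolding V_def w_def m_def by linarith
  qed
  have upper: "q p + 1 / (2 * \<gamma>) * (norm (p - (w + d)))\<^sup>2 \<le> V + s \<bullet> d + C * (norm d)\<^sup>2" for d
  proof -
    have "1 / (2 * \<gamma>) * (norm (p - (w + d)))\<^sup>2
        = \<gamma> / 2 * (norm s)\<^sup>2 + s \<bullet> d + 1 / (2 * \<gamma>) * (norm d)\<^sup>2"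
      using \<gamma> unfolding power2_norm_eq_inner
      by (simp add: w_def inner_simps inner_commute field_simps power2_eq_square)
    moreover have "1 / (2 * \<gamma>) * (norm d)\<^sup>2 \<le> C * (norm d)\<^sup>2"
      by (rule mult_right_mono) (auto simp: C_def)
    ultimately show ?thesis
      by (simp add: V_def)
  qed
  have envelope: "\<bar>moreau \<gamma> q (w + d) - V - s \<bullet> d\<bar> \<le> C * (norm d)\<^sup>2" for d
  proof -
    have "V + s \<bullet> d - C * (norm d)\<^sup>2 \<le> moreau \<gamma> q (w + d)"
      unfolding moreau_def by (rule cINF_greatest) (use lower in auto)
    moreover have "moreau \<gamma> q (w + d) \<le> q p + 1 / (2 * \<gamma>) * (norm (p - (w + d)))\<^sup>2"
      unfolding moreau_def
      by (rule cINF_lower) (use lower in \<open>auto intro!: bdd_belowI2\<close>)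
    ultimately show ?thesis
      using upper[of d] by linarith
  qed
  have at_w: "moreau \<gamma> q w = V"
    using envelope[of 0] by simp
  have "(moreau \<gamma> q has_derivative (\<lambda>d. d \<bullet> s)) (at w)"
    unfolding has_derivative_iff_norm
  proof
    show "bounded_linear (\<lambda>d. d \<bullet> s)"
      by (rule bounded_linear_inner_left)
    have "((\<lambda>y. C * norm (y - w)) \<longlongrightarrow> C * norm (w - w)) (at w)"
      by (intro tendsto_intros)
    then have lim: "((\<lambda>y. C * norm (y - w)) \<longlongrightarrow> 0) (at w)"
      by simp
    have "norm (norm (moreau \<gamma> q y - moreau \<gamma> q w - (y - w) \<bullet> s) / norm (y - w))
        \<le> C * norm (y - w)" for y
      using envelope[of "y - w"] at_w
      by (cases "y = w")
        (simp_all add: divide_le_eq inner_commute[of s] power2_eq_square mult.assoc)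
    then show "((\<lambda>y. norm (moreau \<gamma> q y - moreau \<gamma> q w - (y - w) \<bullet> s) / norm (y - w)) \<longlongrightarrow> 0) (at w)"
      by (intro Lim_null_comparison[OF _ lim] always_eventually) simp
  qed
  then show ?thesis
    by (simp add: gderiv_def w_def)
qed

text \<open>
  Every weak subgradient is thus a gradient of the Moreau envelope, so that an implicit subgradient
  property of \<open>q\<close> is a property of its weak subgradients.
\<close>

lemma implicit_lipschitz_weak_subgradient:
  fixes q :: "'a::euclidean_space \<Rightarrow> real"
  assumes "implicit_lipschitz_subgradient \<rho> q L" and "0 < \<rho>"
    and "0 < \<gamma>" and "\<gamma> * \<rho> < 1"
    and "weak_subgradient \<rho> q p s" and "weak_subgradient \<rho> q p' s'"
  shows "norm (s - s') \<le> L \<gamma> * norm (p - p')"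
proof -
  let ?w = "p + \<gamma> *\<^sub>R s" and ?w' = "p' + \<gamma> *\<^sub>R s'"
  have prox: "prox \<gamma> q ?w = p" "prox \<gamma> q ?w' = p'"
    by (rule prox_eq_of_weak_subgradient assms)+
  have grad: "grad (moreau \<gamma> q) ?w = s" "grad (moreau \<gamma> q) ?w' = s'"
    by (rule grad_eq GDERIV_moreau assms)+
  have "\<gamma> < 1 / \<rho>"
    using assms(2,4) by (simp add: field_simps)
  then have "\<forall>u \<in> range (prox \<gamma> q). \<forall>v \<in> range (prox \<gamma> q).
      \<forall>w \<in> prox \<gamma> q -` {u}. \<forall>w' \<in> prox \<gamma> q -` {v}.
        norm (grad (moreau \<gamma> q) w - grad (moreau \<gamma> q) w') \<le> L \<gamma> * norm (u - v)"
    using assms(1,3) by (simp add: implicit_lipschitz_subgradient_def)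
  from this[rule_format, of "prox \<gamma> q ?w" "prox \<gamma> q ?w'" ?w ?w']
  have "norm (grad (moreau \<gamma> q) ?w - grad (moreau \<gamma> q) ?w') \<le> L \<gamma> * norm (p - p')"
    using rangeI[of "prox \<gamma> q" ?w] rangeI[of "prox \<gamma> q" ?w'] by (simp add: prox)
  with grad show ?thesis by simp
qed

lemma implicit_bounded_weak_subgradient:
  fixes q :: "'a::euclidean_space \<Rightarrow> real"
  assumes "implicit_bounded_subgradient \<rho> q M" and "0 < \<rho>"
    and "0 < \<gamma>" and "\<gamma> * \<rho> < 1"
    and "weak_subgradient \<rho> q p s"
  shows "norm s \<le> M \<gamma>"
proof -
  let ?w = "p + \<gamma> *\<^sub>R s"
  have prox: "prox \<gamma> q ?w = p"
    by (rule prox_eq_of_weak_subgradient assms)+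
  have grad: "grad (moreau \<gamma> q) ?w = s"
    by (rule grad_eq GDERIV_moreau assms)+
  have "\<gamma> < 1 / \<rho>"
    using assms(2,4) by (simp add: field_simps)
  then have "\<forall>u \<in> range (prox \<gamma> q). \<forall>w \<in> prox \<gamma> q -` {u}.
      norm (grad (moreau \<gamma> q) w) \<le> M \<gamma>"
    using assms(1,3) by (simp add: implicit_bounded_subgradient_def)
  from this[rule_format, of "prox \<gamma> q ?w" ?w]
  have "norm (grad (moreau \<gamma> q) ?w) \<le> M \<gamma>"
    by simp
  with grad show ?thesis by simp
qed

section \<open>The smallest positive eigenvalue\<close>

lemma matrix_transpose_inner:
  fixes A :: "real^'n^'m"
  shows "(transpose A *v w) \<bullet> u = w \<bullet> (A *v u)"
  by (simp add: dot_lmul_matrix)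

text \<open>
  The minimum \<open>\<mu>\<close> of \<open>\<parallel>A\<^sup>T w\<parallel>\<^sup>2\<close> over unit vectors \<open>w\<close> in the range of \<open>A\<close> is positive since \<open>A\<^sup>T\<close> is
  injective there. A minimiser \<open>w\<close> minimises \<open>\<parallel>A\<^sup>T w\<parallel>\<^sup>2 - \<mu> \<parallel>w\<parallel>\<^sup>2\<close> over that whole subspace, which
  \<open>A A\<^sup>T\<close> maps to itself, so that \<open>A A\<^sup>T w = \<mu> w\<close>; hence \<open>A\<^sup>T w\<close> is an eigenvector of \<open>A\<^sup>T A\<close> for \<open>\<mu>\<close>.
  Conversely an eigenvector \<open>v\<close> of \<open>A\<^sup>T A\<close> for \<open>\<nu> > 0\<close> gives the vector \<open>A v\<close> with quotient \<open>\<nu>\<close>.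
\<close>

lemma min_pos_eigenvalue_lower_bound:
  fixes A :: "real^'n^'m"
  assumes "A \<noteq> 0"
  shows "0 < min_pos_eigenvalue (transpose A ** A)"
    and "w \<in> range ((*v) A) \<Longrightarrow>
      min_pos_eigenvalue (transpose A ** A) * (norm w)\<^sup>2 \<le> (norm (transpose A *v w))\<^sup>2"
proof -
  define R where "R = range ((*v) A)"
  have subspace: "subspace R"
    unfolding R_def by (intro linear_subspace_image) auto
  define S where "S = R \<inter> sphere 0 1"
  have unit: "(1 / norm w) *\<^sub>R w \<in> S" if "w \<in> R" "w \<noteq> 0" for w
    using that subspace by (auto simp: S_def intro: subspace_scale)
  obtain u where u: "A *v u \<noteq> 0"
    using assms by (metis matrix_eq matrix_vector_mult_0)
  have "S \<noteq> {}"
    using unit[of "A *v u"] u by (auto simp: R_def)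
  moreover have "compact S"
    unfolding S_def using closed_subspace[OF subspace] by (simp add: closed_Int_compact)
  moreover have "continuous_on S (\<lambda>w. (norm (transpose A *v w))\<^sup>2)"
    by (intro continuous_intros)
  ultimately obtain w0 where w0: "w0 \<in> S"
    and w0_min: "\<And>w. w \<in> S \<Longrightarrow> (norm (transpose A *v w0))\<^sup>2 \<le> (norm (transpose A *v w))\<^sup>2"
    using continuous_attains_inf[of S "\<lambda>w. (norm (transpose A *v w))\<^sup>2"] by blast
  define \<mu> where "\<mu> = (norm (transpose A *v w0))\<^sup>2"
  have norm_w0: "norm w0 = 1" and w0_R: "w0 \<in> R"
    using w0 by (auto simp: S_def)
  have ineq: "\<mu> * (norm w)\<^sup>2 \<le> (norm (transpose A *v w))\<^sup>2" if "w \<in> R" for w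
  proof (cases "w = 0")
    case False
    have "\<mu> \<le> (norm (transpose A *v ((1 / norm w) *\<^sub>R w)))\<^sup>2"
      unfolding \<mu>_def by (rule w0_min[OF unit[OF that False]])
    also have "\<dots> = (norm (transpose A *v w))\<^sup>2 / (norm w)\<^sup>2"
      unfolding matrix_vector_mult_scaleR by (simp add: power_divide)
    finally show ?thesis
      using False by (simp add: field_simps)
  qed simp
  have "0 < \<mu>"
  proof -
    obtain v where v: "w0 = A *v v"
      using w0_R by (auto simp: R_def)
    have "(transpose A *v w0) \<bullet> v = w0 \<bullet> w0"
      unfolding matrix_transpose_inner v ..
    then have "(transpose A *v w0) \<bullet> v = 1"
      using norm_w0 by (simp add: dot_square_norm)
    then have "transpose A *v w0 \<noteq> 0"
      by (metis inner_zero_left zero_neq_one)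
    then show ?thesis
      by (simp add: \<mu>_def)
  qed
  \<comment> \<open>The first variation of the quadratic form vanishes in every direction of the range.\<close>
  have stationary: "d \<bullet> (A *v (transpose A *v w0) - \<mu> *\<^sub>R w0) = 0" if d: "d \<in> R" for d
  proof -
    define B where "B = (transpose A *v w0) \<bullet> (transpose A *v d) - \<mu> * (w0 \<bullet> d)"
    define Q where "Q = (norm (transpose A *v d))\<^sup>2 - \<mu> * (norm d)\<^sup>2"
    have expansion: "0 \<le> 2 * t * B + t\<^sup>2 * Q" for t
    proof -
      have "w0 + t *\<^sub>R d \<in> R"
        using d w0_R subspace by (intro subspace_add subspace_scale)
      from ineq[OF this] have "\<mu> * (norm (w0 + t *\<^sub>R d))\<^sup>2
          \<le> (norm (transpose A *v w0 + t *\<^sub>R (transpose A *v d)))\<^sup>2"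
        by (metis matrix_vector_mult_scaleR matrix_vector_right_distrib)
      moreover have "\<mu> * (norm (w0 + t *\<^sub>R d))\<^sup>2 = \<mu> + 2 * t * (\<mu> * (w0 \<bullet> d)) + t\<^sup>2 * (\<mu> * (norm d)\<^sup>2)"
        using norm_w0 unfolding power2_norm_eq_inner norm_eq_1
        by (simp add: inner_simps inner_commute algebra_simps power2_eq_square)
      moreover have "(norm (transpose A *v w0 + t *\<^sub>R (transpose A *v d)))\<^sup>2
          = \<mu> + 2 * t * ((transpose A *v w0) \<bullet> (transpose A *v d)) + t\<^sup>2 * (norm (transpose A *v d))\<^sup>2"
        unfolding \<mu>_def power2_norm_eq_inner
        by (simp add: inner_simps inner_commute algebra_simps power2_eq_square)
      ultimately show ?thesis
        by (simp add: B_def Q_def algebra_simps)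
    qed
    \<comment> \<open>At \<open>t = - B / K\<close> the linear term outweighs the quadratic one unless \<open>B = 0\<close>.\<close>
    define K where "K = \<bar>Q\<bar> + 1"
    have "0 \<le> 2 * (- B / K) * B + (- B / K)\<^sup>2 * Q"
      by (rule expansion)
    also have "\<dots> \<le> 2 * (- B / K) * B + (- B / K)\<^sup>2 * K"
      by (intro add_left_mono mult_left_mono) (auto simp: K_def)
    also have "\<dots> = - (B\<^sup>2 / K)"
      by (simp add: K_def power2_eq_square)
    finally have "B\<^sup>2 / K \<le> 0"
      by simp
    moreover have "0 < K"
      by (simp add: K_def)
    ultimately have "B = 0"
      by (simp add: divide_le_0_iff)
    moreover have "d \<bullet> (A *v (transpose A *v w0)) = (transpose A *v w0) \<bullet> (transpose A *v d)"
      by (metis inner_commute matrix_transpose_inner)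
    ultimately show ?thesis
      by (simp add: B_def inner_simps inner_commute[of d w0])
  qed
  have "A *v (transpose A *v w0) - \<mu> *\<^sub>R w0 \<in> R"
    using w0_R subspace by (intro subspace_diff subspace_scale) (auto simp: R_def)
  from stationary[OF this] have eig: "A *v (transpose A *v w0) = \<mu> *\<^sub>R w0"
    by (simp add: inner_eq_zero_iff)
  have "min_pos_eigenvalue (transpose A ** A) = \<mu>"
    unfolding min_pos_eigenvalue_def
  proof (rule Least_equality)
    have "transpose A *v w0 \<noteq> 0"
      using \<open>0 < \<mu>\<close> by (auto simp: \<mu>_def)
    moreover have "(transpose A ** A) *v (transpose A *v w0) = \<mu> *\<^sub>R (transpose A *v w0)"
      unfolding matrix_vector_mul_assoc[symmetric] eig by (rule matrix_vector_mult_scaleR)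
    ultimately show "0 < \<mu> \<and> (\<exists>v. v \<noteq> 0 \<and> (transpose A ** A) *v v = \<mu> *\<^sub>R v)"
      using \<open>0 < \<mu>\<close> by blast
  next
    fix \<nu>
    assume "0 < \<nu> \<and> (\<exists>v. v \<noteq> 0 \<and> (transpose A ** A) *v v = \<nu> *\<^sub>R v)"
    then obtain v where \<nu>: "0 < \<nu>" and v: "v \<noteq> 0"
      and "(transpose A ** A) *v v = \<nu> *\<^sub>R v" by blast
    then have eig_v: "transpose A *v (A *v v) = \<nu> *\<^sub>R v"
      unfolding matrix_vector_mul_assoc by blast
    have "(norm (A *v v))\<^sup>2 = (transpose A *v (A *v v)) \<bullet> v"
      unfolding matrix_transpose_inner by (rule power2_norm_eq_inner)
    also have "\<dots> = \<nu> * (norm v)\<^sup>2"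
      unfolding eig_v by (simp add: power2_norm_eq_inner)
    finally have "\<mu> * (\<nu> * (norm v)\<^sup>2) \<le> \<nu>\<^sup>2 * (norm v)\<^sup>2"
      using ineq[of "A *v v"] unfolding eig_v by (simp add: R_def power_mult_distrib)
    with \<nu> v show "\<mu> \<le> \<nu>"
      by (simp add: power2_eq_square)
  qed
  with \<open>0 < \<mu>\<close> ineq show "0 < min_pos_eigenvalue (transpose A ** A)"
    and "w \<in> range ((*v) A) \<Longrightarrow>
      min_pos_eigenvalue (transpose A ** A) * (norm w)\<^sup>2 \<le> (norm (transpose A *v w))\<^sup>2"
    by (auto simp: R_def)
qed

section \<open>Running minima of summable sequences\<close>

lemma sum_le_of_descent:
  fixes E r :: "nat \<Rightarrow> real"
  assumes "\<And>k. 1 \<le> k \<Longrightarrow> E (Suc k) + c * r k \<le> E k + \<epsilon>"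
  shows "c * (\<Sum>k = 1..n. r k) \<le> E 1 - E (Suc n) + real n * \<epsilon>"
proof (induction n)
  case (Suc n)
  then show ?case
    using assms[of "Suc n"] by (simp add: algebra_simps)
qed simp

lemma running_min_le:
  fixes r :: "nat \<Rightarrow> real"
  assumes "\<And>k. 0 \<le> r k" and "m \<le> n" and "(\<Sum>k = m..n. (r k)\<^sup>2) \<le> B"
  shows "real (Suc n - m) * (Min (r ` {0..n}))\<^sup>2 \<le> B"
proof -
  have "0 \<le> Min (r ` {0..n})"
    using assms(1) by simp
  then have "(Min (r ` {0..n}))\<^sup>2 \<le> (r k)\<^sup>2" if "k \<in> {m..n}" for k
    using that by (intro power_mono) auto
  then have "real (card {m..n}) * (Min (r ` {0..n}))\<^sup>2 \<le> (\<Sum>k = m..n. (r k)\<^sup>2)"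
    by (rule sum_bounded_below)
  with assms(3) show ?thesis
    by simp
qed

text \<open>
  Averaging over the indices from a fixed \<open>N\<close> up to \<open>k\<close> only uses a tail of the series, which is
  arbitrarily small, and costs at most a factor \<open>2\<close> in the number of terms once \<open>k \<ge> 2 N\<close>.
\<close>

lemma running_min_smallo:
  fixes r :: "nat \<Rightarrow> real"
  assumes nonneg: "\<And>k. 0 \<le> r k" and summable: "summable (\<lambda>k. (r k)\<^sup>2)"
  shows "(\<lambda>k. Min (r ` {0..k})) \<in> o(\<lambda>k. 1 / sqrt (real k))"
proof (rule landau_o.smallI)
  fix c :: real
  assume "0 < c"
  then obtain N where N: "\<And>m n. m \<ge> N \<Longrightarrow> norm (\<Sum>k = m..<n. (r k)\<^sup>2) < c\<^sup>2 / 2"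
    using summable unfolding summable_Cauchy by (metis half_gt_zero zero_less_power)
  show "\<forall>\<^sub>F k in at_top. norm (Min (r ` {0..k})) \<le> c * norm (1 / sqrt (real k))"
    using eventually_ge_at_top[of "2 * N + 1"]
  proof eventually_elim
    case (elim k)
    let ?\<xi> = "Min (r ` {0..k})"
    have "(\<Sum>i = N..k. (r i)\<^sup>2) \<le> c\<^sup>2 / 2"
      using N[of N "Suc k"] by (simp add: atLeastLessThanSuc_atLeastAtMost)
    then have "real (Suc k - N) * ?\<xi>\<^sup>2 \<le> c\<^sup>2 / 2"
      using nonneg elim by (intro running_min_le) auto
    moreover have "real k / 2 * ?\<xi>\<^sup>2 \<le> real (Suc k - N) * ?\<xi>\<^sup>2"
      using elim by (intro mult_right_mono) auto
    ultimately have "real k * ?\<xi>\<^sup>2 \<le> c\<^sup>2"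
      by linarith
    then have "(sqrt (real k) * ?\<xi>)\<^sup>2 \<le> c\<^sup>2"
      by (simp add: power_mult_distrib)
    then have "sqrt (real k) * ?\<xi> \<le> c"
      using \<open>0 < c\<close> by (simp add: abs_le_square_iff[symmetric])
    moreover have "0 \<le> ?\<xi>"
      using nonneg by simp
    ultimately show ?case
      using elim by (simp add: field_simps)
  qed
qed

section \<open>Descent along a run\<close>

lemma power2_sum3_le: "(a + b + c)\<^sup>2 \<le> 3 * (a\<^sup>2 + b\<^sup>2 + c\<^sup>2)" for a b c :: real
proof -
  have "0 \<le> (a - b)\<^sup>2 + (a - c)\<^sup>2 + (b - c)\<^sup>2" by simp
  then show ?thesis by (simp add: power2_eq_square algebra_simps)
qed

lemma power2_sum4_le: "(a + b + c + d)\<^sup>2 \<le> 4 * (a\<^sup>2 + b\<^sup>2 + c\<^sup>2 + d\<^sup>2)" for a b c d :: real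
proof -
  have "0 \<le> (a - b)\<^sup>2 + (a - c)\<^sup>2 + (a - d)\<^sup>2 + (b - c)\<^sup>2 + (b - d)\<^sup>2 + (c - d)\<^sup>2" by simp
  then show ?thesis by (simp add: power2_eq_square algebra_simps)
qed

locale limeal_run =
  fixes A :: "real^'n^'m" and b :: "real^'m" and h g :: "real^'n \<Rightarrow> real"
    and L \<rho> \<eta> \<gamma> :: real and \<beta> :: "nat \<Rightarrow> real"
    and x z :: "nat \<Rightarrow> real^'n" and l :: "nat \<Rightarrow> real^'m"
  assumes feasible: "b \<in> range ((*v) A)"
    and h_grad: "\<And>u. GDERIV h u :> grad h u"
    and h_lip: "\<And>u v. norm (grad h u - grad h v) \<le> L * norm (u - v)"
    and g_wc: "weakly_convex \<rho> g"
    and eta: "0 < \<eta>" "\<eta> < 2"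
    and gamma: "0 < \<gamma>" "\<gamma> * \<rho> < 1"
    and run: "limeal h g A b \<gamma> \<eta> \<beta> x z l"
begin

definition merit :: "nat \<Rightarrow> real" where
  "merit k = prox_aug_lagrangian (\<lambda>y. h y + g y) A b \<gamma> (\<beta> k) (x k) (z k) (l k)"

definition residual :: "nat \<Rightarrow> real" where
  "residual k = norm (limeal_residual h \<gamma> \<beta> x z l k)"

definition primal_step :: "nat \<Rightarrow> real" where
  "primal_step k = norm (x (Suc k) - x k)"

definition prox_center_step :: "nat \<Rightarrow> real" where
  "prox_center_step k = norm (z (Suc k) - z k)"

text \<open>
  The optimality condition of the subproblem, solved for the element of \<open>\<partial>g\<close>. The penalty term has
  been absorbed into the updated multiplier.
\<close>

definition subgrad :: "nat \<Rightarrow> real^'n" where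
  "subgrad k = - grad h (x k) - transpose A *v l (Suc k) - (1 / \<gamma>) *\<^sub>R (x (Suc k) - z k)"

lemma beta_pos: "0 < \<beta> k"
  and x_step: "is_arg_min (\<lambda>y. prox_aug_lagrangian (linearised h g (x k)) A b \<gamma> (\<beta> k) y (z k) (l k))
      (\<lambda>_. True) (x (Suc k))"
  and z_step: "z (Suc k) = z k - \<eta> *\<^sub>R (z k - x (Suc k))"
  and l_step: "l (Suc k) = l k + \<beta> k *\<^sub>R (A *v x (Suc k) - b)"
  using run unfolding limeal_def by auto

lemma subgrad_weak_subgradient: "weak_subgradient \<rho> g (x (Suc k)) (subgrad k)"
proof -
  let ?p = "x (Suc k)"
  define \<psi> where "\<psi> y = h (x k) + grad h (x k) \<bullet> (y - x k) + (l k \<bullet> (A *v y - b)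
    + \<beta> k / 2 * ((A *v y - b) \<bullet> (A *v y - b)) + 1 / (2 * \<gamma>) * ((y - z k) \<bullet> (y - z k)))" for y
  have min: "g ?p + \<psi> ?p \<le> g y + \<psi> y" for y
    using x_step[of k]
    unfolding is_arg_min_linorder prox_aug_lagrangian_def aug_lagrangian_def linearised_def
      \<psi>_def power2_norm_eq_inner
    by (simp add: add_ac)
  have affine: "((\<lambda>y. A *v y - b) has_derivative (\<lambda>d. A *v d)) (at ?p)"
    using bounded_linear_imp_has_derivative[OF matrix_vector_mul_bounded_linear[of A]]
    by (auto intro!: derivative_eq_intros)
  have "(\<psi> has_derivative (\<lambda>d. grad h (x k) \<bullet> d + (l k \<bullet> (A *v d)
      + \<beta> k / 2 * ((A *v ?p - b) \<bullet> (A *v d) + (A *v d) \<bullet> (A *v ?p - b))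
      + 1 / (2 * \<gamma>) * ((?p - z k) \<bullet> d + d \<bullet> (?p - z k))))) (at ?p)"
    unfolding \<psi>_def
    by (rule derivative_eq_intros affine refl | simp)+
  moreover have "grad h (x k) \<bullet> d + (l k \<bullet> (A *v d)
      + \<beta> k / 2 * ((A *v ?p - b) \<bullet> (A *v d) + (A *v d) \<bullet> (A *v ?p - b))
      + 1 / (2 * \<gamma>) * ((?p - z k) \<bullet> d + d \<bullet> (?p - z k))) = d \<bullet> (- subgrad k)" for d
  proof -
    have "d \<bullet> (- subgrad k) = grad h (x k) \<bullet> d + (transpose A *v l (Suc k)) \<bullet> d
        + (1 / \<gamma>) * ((?p - z k) \<bullet> d)"
      by (simp add: subgrad_def inner_simps inner_commute del: transpose_matrix_vector)
    also have "(transpose A *v l (Suc k)) \<bullet> d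
        = l k \<bullet> (A *v d) + \<beta> k * ((A *v ?p - b) \<bullet> (A *v d))"
      unfolding matrix_transpose_inner l_step by (simp add: inner_simps)
    finally show ?thesis
      using gamma(1) by (simp add: inner_commute field_simps)
  qed
  ultimately have "GDERIV \<psi> ?p :> - subgrad k"
    by (simp add: gderiv_def)
  from weak_subgradient_of_minimiser[OF g_wc min this] show ?thesis
    by simp
qed

lemma dual_step_in_range: "l (Suc k) - l k \<in> range ((*v) A)"
proof -
  obtain u where "b = A *v u"
    using feasible by blast
  then have "l (Suc k) - l k = A *v (\<beta> k *\<^sub>R (x (Suc k) - u))"
    by (simp add: l_step matrix_vector_mult_scaleR matrix_vector_mult_diff_distrib)
  then show ?thesis
    by blast
qed

text \<open>
  This is what the constants \<open>\<alpha>\<^sub>k\<close> are for: dual steps lie in the range of \<open>A\<close>, so their length is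
  controlled by that of their image under \<open>A\<^sup>T\<close>, which optimality expresses by primal quantities.
  Written with \<open>A\<^sup>T\<close> on the right-hand side, the estimate also holds for \<open>A = 0\<close>, where \<open>\<alpha>\<^sub>k\<close> is an
  arbitrary number: both sides vanish.
\<close>

lemma infeasibility_le_dual_step:
  "(\<beta> k + \<beta> (Suc k) + \<gamma> * (\<eta> * (1 - \<eta> / 2))) / 2 * (norm (A *v x (Suc k) - b))\<^sup>2
    \<le> limeal_alpha A \<gamma> \<eta> \<beta> k * (\<gamma> * norm (transpose A *v (l (Suc k) - l k)))\<^sup>2"
proof (cases "A = 0")
  case True
  have "A *v x (Suc k) - b = 0"
    using feasible True by auto
  moreover have "transpose A = 0"
    using True by (simp add: transpose_def vec_eq_iff)
  ultimately show ?thesis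
    by simp
next
  case False
  define \<sigma> where "\<sigma> = min_pos_eigenvalue (transpose A ** A)"
  define w where "w = l (Suc k) - l k"
  have \<sigma>: "0 < \<sigma>" "\<sigma> * (norm w)\<^sup>2 \<le> (norm (transpose A *v w))\<^sup>2"
    using min_pos_eigenvalue_lower_bound[OF False] dual_step_in_range[of k]
    by (auto simp: \<sigma>_def w_def)
  let ?a = "limeal_alpha A \<gamma> \<eta> \<beta> k"
  define N where "N = \<beta> k + \<beta> (Suc k) + \<gamma> * (\<eta> * (1 - \<eta> / 2))"
  have "0 \<le> \<eta> * (1 - \<eta> / 2)"
    using eta by simp
  then have "0 \<le> N"
    using beta_pos[of k] beta_pos[of "Suc k"] gamma(1) by (simp add: N_def add_nonneg_nonneg)
  have a_eq: "?a = N / (2 * (\<gamma>\<^sup>2 * \<sigma>) * (\<beta> k)\<^sup>2)"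
    by (simp add: limeal_alpha_def c_const_def \<sigma>_def N_def mult.assoc)
  have "norm w = \<beta> k * norm (A *v x (Suc k) - b)"
    using beta_pos[of k] by (simp add: w_def l_step)
  then have "N / 2 * (norm (A *v x (Suc k) - b))\<^sup>2 = ?a * \<gamma>\<^sup>2 * (\<sigma> * (norm w)\<^sup>2)"
    using \<sigma>(1) beta_pos[of k] gamma(1) by (simp add: a_eq power_mult_distrib)
  also have "\<dots> \<le> ?a * \<gamma>\<^sup>2 * (norm (transpose A *v w))\<^sup>2"
    using \<sigma> \<open>0 \<le> N\<close> by (intro mult_left_mono) (auto simp: a_eq)
  finally show ?thesis
    by (simp add: N_def w_def power_mult_distrib mult.assoc)
qed

lemma residual_le:
  "(residual k)\<^sup>2 \<le> 2 / \<gamma>\<^sup>2 * (norm (z k - x (Suc k)))\<^sup>2 + 2 * L\<^sup>2 * (primal_step k)\<^sup>2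
    + (norm (A *v x (Suc k) - b))\<^sup>2"
proof -
  let ?u = "(1 / \<gamma>) *\<^sub>R (z k - x (Suc k))" and ?v = "grad h (x (Suc k)) - grad h (x k)"
  have "(1 / \<beta> k) *\<^sub>R (l (Suc k) - l k) = A *v x (Suc k) - b"
    using beta_pos[of k] by (simp add: l_step)
  then have "(residual k)\<^sup>2 = (norm (?u + ?v))\<^sup>2 + (norm (A *v x (Suc k) - b))\<^sup>2"
    by (simp add: residual_def limeal_residual_def norm_Pair add_diff_eq)
  moreover have "(norm (?u + ?v))\<^sup>2 \<le> (norm ?u + norm ?v)\<^sup>2"
    by (intro power_mono norm_triangle_ineq) simp
  moreover have "(norm ?u + norm ?v)\<^sup>2 \<le> 2 * (norm ?u)\<^sup>2 + 2 * (norm ?v)\<^sup>2"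
    using sum_squares_bound[of "norm ?u" "norm ?v"] by (simp add: power2_sum)
  moreover have "2 * (norm ?u)\<^sup>2 = 2 / \<gamma>\<^sup>2 * (norm (z k - x (Suc k)))\<^sup>2"
    by (simp add: power_divide)
  moreover have "(norm ?v)\<^sup>2 \<le> L\<^sup>2 * (primal_step k)\<^sup>2"
    unfolding primal_step_def power_mult_distrib[symmetric] by (intro power_mono h_lip) simp
  ultimately show ?thesis
    by linarith
qed

text \<open>
  The three updates in turn: the proximal step decreases the Lagrangian by strong convexity, the
  relaxation of the centre \<open>z\<close> decreases the proximal term, and the dual step and the change of
  penalty increase it by a multiple of the squared infeasibility. Half of the decrease in \<open>z\<close>, and
  the part \<open>\<eta> (1 - \<eta> / 2) \<gamma>\<^sup>2 L\<^sup>2\<close> of the decrease in \<open>x\<close>, pay for the first component of the residual;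
  its second component is the infeasibility, which is why \<open>\<alpha>\<^sub>k\<close> contains \<open>\<gamma> \<eta> (1 - \<eta> / 2)\<close> besides the
  penalties.
\<close>

lemma merit_descent:
  "merit (Suc k)
      + (1 - \<gamma> * (\<rho> + L) - \<eta> * (1 - \<eta> / 2) * \<gamma>\<^sup>2 * L\<^sup>2) / (2 * \<gamma>) * (primal_step k)\<^sup>2
      + (2 / \<eta> - 1) / (4 * \<gamma>) * (prox_center_step k)\<^sup>2
      + \<gamma> * (\<eta> * (1 - \<eta> / 2)) / 4 * (residual k)\<^sup>2
    \<le> merit k + limeal_alpha A \<gamma> \<eta> \<beta> k * (\<gamma> * norm (transpose A *v (l (Suc k) - l k)))\<^sup>2"
proof -
  define \<kappa> where "\<kappa> = \<eta> * (1 - \<eta> / 2)"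
  let ?u = "x k" and ?v = "x (Suc k)"
  define r where "r = A *v ?v - b"
  define e where "e = A *v (?u - ?v)"
  define N where "N = (primal_step k)\<^sup>2"
  define W where "W = (norm (z k - ?v))\<^sup>2"
  define I where "I = (?v - z k) \<bullet> (?u - ?v)"
  have Au: "A *v ?u - b = r + e"
    by (simp add: r_def e_def matrix_vector_mult_diff_distrib)
  have N_eq: "N = (norm (?u - ?v))\<^sup>2"
    by (simp add: N_def primal_step_def norm_minus_commute)
  have "g ?v + subgrad k \<bullet> (?u - ?v) - \<rho> / 2 * N \<le> g ?u"
    using weak_subgradientD[OF subgrad_weak_subgradient] by (simp add: N_eq)
  moreover have "subgrad k \<bullet> (?u - ?v)
      = grad h ?u \<bullet> (?v - ?u) - (l k \<bullet> e + \<beta> k * (r \<bullet> e)) - I / \<gamma>"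
  proof -
    have "(transpose A *v l (Suc k)) \<bullet> (?u - ?v) = l k \<bullet> e + \<beta> k * (r \<bullet> e)"
      unfolding matrix_transpose_inner l_step e_def r_def by (simp add: inner_simps)
    then show ?thesis
      by (simp add: subgrad_def I_def inner_diff_left inner_diff_right[of "grad h ?u"]
          del: transpose_matrix_vector)
  qed
  moreover have "h ?v \<le> h ?u + grad h ?u \<bullet> (?v - ?u) + L / 2 * N"
    unfolding N_def primal_step_def by (rule lipschitz_gradient_upper_bound[OF h_grad h_lip])
  moreover have "merit k = h ?u + g ?u + (l k \<bullet> r + l k \<bullet> e)
      + \<beta> k / 2 * ((norm r)\<^sup>2 + 2 * (r \<bullet> e) + (norm e)\<^sup>2) + 1 / (2 * \<gamma>) * (W + 2 * I + N)"
  proof -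
    have "(norm (r + e))\<^sup>2 = (norm r)\<^sup>2 + 2 * (r \<bullet> e) + (norm e)\<^sup>2"
      unfolding power2_norm_eq_inner by (simp add: inner_simps inner_commute)
    moreover have "(norm (?u - z k))\<^sup>2 = W + 2 * I + N"
      unfolding power2_norm_eq_inner W_def N_eq I_def by (simp add: inner_simps inner_commute)
    ultimately show ?thesis
      unfolding merit_def prox_aug_lagrangian_def aug_lagrangian_def Au
      by (simp add: inner_add_right)
  qed
  moreover have "merit (Suc k) = h ?v + g ?v + (l k \<bullet> r + \<beta> k * (norm r)\<^sup>2)
      + \<beta> (Suc k) / 2 * (norm r)\<^sup>2 + 1 / (2 * \<gamma>) * ((1 - \<eta>)\<^sup>2 * W)"
  proof -
    have "?v - z (Suc k) = (\<eta> - 1) *\<^sub>R (z k - ?v)"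
      by (simp add: z_step algebra_simps)
    then have "(norm (?v - z (Suc k)))\<^sup>2 = (1 - \<eta>)\<^sup>2 * W"
      by (simp add: W_def power_mult_distrib power2_commute)
    then show ?thesis
      unfolding merit_def prox_aug_lagrangian_def aug_lagrangian_def r_def[symmetric]
      by (simp add: l_step r_def[symmetric] inner_add_left power2_norm_eq_inner)
  qed
  ultimately have "merit (Suc k) \<le> merit k + ((\<rho> + L) / 2 - 1 / (2 * \<gamma>)) * N
      - \<beta> k / 2 * (norm e)\<^sup>2 + (\<beta> k + \<beta> (Suc k)) / 2 * (norm r)\<^sup>2 - (1 - (1 - \<eta>)\<^sup>2) / (2 * \<gamma>) * W"
    by (simp add: ring_distribs add_divide_distrib diff_divide_distrib)
  moreover have "0 \<le> \<beta> k / 2 * (norm e)\<^sup>2"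
    using beta_pos[of k] by simp
  moreover have "(1 - (1 - \<eta>)\<^sup>2) / (2 * \<gamma>) * W
      = (2 / \<eta> - 1) / (4 * \<gamma>) * (prox_center_step k)\<^sup>2 + \<gamma> * \<kappa> / 4 * (2 / \<gamma>\<^sup>2 * W)"
  proof -
    have "prox_center_step k = \<eta> * norm (z k - ?v)"
      using eta by (simp add: prox_center_step_def z_step)
    then show ?thesis
      using eta gamma(1) by (simp add: W_def \<kappa>_def power_mult_distrib field_simps power2_eq_square)
  qed
  moreover have "((\<rho> + L) / 2 - 1 / (2 * \<gamma>)) * N
      = - ((1 - \<gamma> * (\<rho> + L) - \<kappa> * \<gamma>\<^sup>2 * L\<^sup>2) / (2 * \<gamma>) * N) - \<gamma> * \<kappa> / 4 * (2 * L\<^sup>2 * N)"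
    using gamma(1) by (simp add: field_simps power2_eq_square)
  moreover have "\<gamma> * \<kappa> / 4 * (residual k)\<^sup>2
      \<le> \<gamma> * \<kappa> / 4 * (2 / \<gamma>\<^sup>2 * W) + \<gamma> * \<kappa> / 4 * (2 * L\<^sup>2 * N) + \<gamma> * \<kappa> / 4 * (norm r)\<^sup>2"
    using residual_le[of k] eta gamma(1) unfolding distrib_left[symmetric]
    by (intro mult_left_mono) (auto simp: \<kappa>_def W_def N_def r_def)
  moreover have "0 \<le> \<gamma> * \<kappa> / 4 * (norm r)\<^sup>2"
    using eta gamma(1) by (simp add: \<kappa>_def)
  moreover have "(\<beta> k + \<beta> (Suc k) + \<gamma> * \<kappa>) / 2 * (norm r)\<^sup>2
      \<le> limeal_alpha A \<gamma> \<eta> \<beta> k * (\<gamma> * norm (transpose A *v (l (Suc k) - l k)))\<^sup>2"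
    using infeasibility_le_dual_step[of k] by (simp add: \<kappa>_def r_def)
  moreover have "(\<beta> k + \<beta> (Suc k) + \<gamma> * \<kappa>) / 2 * (norm r)\<^sup>2
      = (\<beta> k + \<beta> (Suc k)) / 2 * (norm r)\<^sup>2 + 2 * (\<gamma> * \<kappa> / 4 * (norm r)\<^sup>2)"
    by (simp add: algebra_simps add_divide_distrib)
  ultimately show ?thesis
    unfolding \<kappa>_def[symmetric] N_def[symmetric] by linarith
qed

lemma dual_step_le:
  "\<gamma> * norm (transpose A *v (l (Suc (Suc k)) - l (Suc k)))
    \<le> primal_step (Suc k) + \<gamma> * norm (subgrad (Suc k) - subgrad k)
      + \<gamma> * L * primal_step k + prox_center_step k"
proof -
  let ?w = "transpose A *v (l (Suc (Suc k)) - l (Suc k))"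
  let ?h = "grad h (x (Suc k)) - grad h (x k)" and ?s = "subgrad (Suc k) - subgrad k"
  let ?z = "z (Suc k) - z k" and ?x = "x (Suc (Suc k)) - x (Suc k)"
  have "?w = (1 / \<gamma>) *\<^sub>R (?z - ?x) - ?s - ?h"
    unfolding subgrad_def matrix_vector_mult_diff_distrib scaleR_right_diff_distrib by simp
  then have scaled: "\<gamma> *\<^sub>R ?w = ?z - ?x - \<gamma> *\<^sub>R ?s - \<gamma> *\<^sub>R ?h"
    using gamma(1) by (simp add: scaleR_right_diff_distrib del: transpose_matrix_vector)
  have "norm (\<gamma> *\<^sub>R ?w) \<le> norm ?z + norm ?x + norm (\<gamma> *\<^sub>R ?s) + norm (\<gamma> *\<^sub>R ?h)"
    unfolding scaled
    using norm_triangle_ineq4[of "?z - ?x - \<gamma> *\<^sub>R ?s" "\<gamma> *\<^sub>R ?h"]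
      norm_triangle_ineq4[of "?z - ?x" "\<gamma> *\<^sub>R ?s"] norm_triangle_ineq4[of ?z ?x]
    by linarith
  moreover have scale: "norm (\<gamma> *\<^sub>R v) = \<gamma> * norm v" for v :: "real^'n"
    using gamma(1) by simp
  moreover have "\<gamma> * norm ?h \<le> \<gamma> * L * primal_step k"
    unfolding primal_step_def mult.assoc using gamma(1) h_lip by (intro mult_left_mono) auto
  ultimately show ?thesis
    unfolding primal_step_def prox_center_step_def scale by linarith
qed

text \<open>
  The dual step of iteration \<open>k + 1\<close> is charged partly to the steps of iteration \<open>k\<close>. Carrying those
  squared steps along as an additional term of the energy turns the estimate into a descent.
\<close>

lemma energy_descent:
  assumes dual: "(\<gamma> * norm (transpose A *v (l (Suc (Suc k)) - l (Suc k))))\<^sup>2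
      \<le> c * (p * (primal_step (Suc k))\<^sup>2 + \<gamma>\<^sup>2 * L\<^sup>2 * (primal_step k)\<^sup>2 + (prox_center_step k)\<^sup>2 + \<omega>)"
    and a: "0 \<le> a" "limeal_alpha A \<gamma> \<eta> \<beta> (Suc k) \<le> a"
    and primal: "c * a * (p + \<gamma>\<^sup>2 * L\<^sup>2)
      \<le> (1 - \<gamma> * (\<rho> + L) - \<eta> * (1 - \<eta> / 2) * \<gamma>\<^sup>2 * L\<^sup>2) / (2 * \<gamma>)"
    and center: "c * a \<le> (2 / \<eta> - 1) / (4 * \<gamma>)"
  shows "merit (Suc (Suc k))
      + c * a * (\<gamma>\<^sup>2 * L\<^sup>2 * (primal_step (Suc k))\<^sup>2 + (prox_center_step (Suc k))\<^sup>2)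
      + \<gamma> * (\<eta> * (1 - \<eta> / 2)) / 4 * (residual (Suc k))\<^sup>2
    \<le> merit (Suc k) + c * a * (\<gamma>\<^sup>2 * L\<^sup>2 * (primal_step k)\<^sup>2 + (prox_center_step k)\<^sup>2) + c * a * \<omega>"
proof -
  let ?d = "(\<gamma> * norm (transpose A *v (l (Suc (Suc k)) - l (Suc k))))\<^sup>2"
  let ?b = "c * (p * (primal_step (Suc k))\<^sup>2 + \<gamma>\<^sup>2 * L\<^sup>2 * (primal_step k)\<^sup>2 + (prox_center_step k)\<^sup>2 + \<omega>)"
  have "limeal_alpha A \<gamma> \<eta> \<beta> (Suc k) * ?d \<le> a * ?d"
    by (rule mult_right_mono[OF a(2)]) simp
  also have "\<dots> \<le> a * ?b"
    by (rule mult_left_mono[OF dual a(1)])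
  finally have "limeal_alpha A \<gamma> \<eta> \<beta> (Suc k) * ?d \<le> a * ?b" .
  moreover have "a * ?b = c * a * (p + \<gamma>\<^sup>2 * L\<^sup>2) * (primal_step (Suc k))\<^sup>2
      - c * a * (\<gamma>\<^sup>2 * L\<^sup>2 * (primal_step (Suc k))\<^sup>2)
      + c * a * (\<gamma>\<^sup>2 * L\<^sup>2 * (primal_step k)\<^sup>2 + (prox_center_step k)\<^sup>2) + c * a * \<omega>"
    by (simp add: algebra_simps)
  moreover have "c * a * (p + \<gamma>\<^sup>2 * L\<^sup>2) * (primal_step (Suc k))\<^sup>2
      \<le> (1 - \<gamma> * (\<rho> + L) - \<eta> * (1 - \<eta> / 2) * \<gamma>\<^sup>2 * L\<^sup>2) / (2 * \<gamma>) * (primal_step (Suc k))\<^sup>2"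
    by (rule mult_right_mono[OF primal]) simp
  moreover have "c * a * (prox_center_step (Suc k))\<^sup>2
      \<le> (2 / \<eta> - 1) / (4 * \<gamma>) * (prox_center_step (Suc k))\<^sup>2"
    by (rule mult_right_mono[OF center]) simp
  ultimately show ?thesis
    using merit_descent[of "Suc k"] unfolding distrib_left[of "c * a"] by linarith
qed

text \<open>
  Testing optimality with \<open>x\<^sup>1 - y\<close> for a feasible \<open>y\<close>, the penalty contributes
  \<open>\<beta>\<^sub>0 \<parallel>A x\<^sup>1 - b\<parallel>\<^sup>2 \<ge> 0\<close> and can be dropped, which bounds \<open>x\<^sup>1\<close> independently of \<open>\<beta>\<^sub>0\<close>.
\<close>

lemma first_iterate_near_feasible:
  assumes "A *v y = b" and "norm (subgrad 0) \<le> M"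
    and R: "R = \<gamma> * (M + norm (grad h (x 0) + transpose A *v l 0 + (1 / \<gamma>) *\<^sub>R (y - z 0)))"
  shows "norm (x 1 - y) \<le> R"
    and "\<gamma> * norm (transpose A *v (l 1 - l 0)) \<le> 2 * R"
proof -
  define q where "q = grad h (x 0) + transpose A *v l 0 + (1 / \<gamma>) *\<^sub>R (y - z 0)"
  define d where "d = x 1 - y"
  have bound: "norm (- subgrad 0 - q) \<le> R / \<gamma>"
    using norm_triangle_ineq4[of "- subgrad 0" q] assms(2) gamma(1) by (simp add: R q_def)
  have step: "transpose A *v (l 1 - l 0) = (- subgrad 0 - q) - (1 / \<gamma>) *\<^sub>R d"
    unfolding matrix_vector_mult_diff_distrib
    by (simp add: subgrad_def q_def d_def algebra_simps del: transpose_matrix_vector)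
  have "(transpose A *v (l 1 - l 0)) \<bullet> d = \<beta> 0 * (norm (A *v d))\<^sup>2"
    unfolding matrix_transpose_inner using l_step[of 0] assms(1)
    by (simp add: d_def matrix_vector_mult_diff_distrib power2_norm_eq_inner)
  then have "0 \<le> (transpose A *v (l 1 - l 0)) \<bullet> d"
    using beta_pos[of 0] by simp
  then have "1 / \<gamma> * (norm d)\<^sup>2 \<le> (- subgrad 0 - q) \<bullet> d"
    unfolding step by (simp add: inner_diff_left[of _ "(1 / \<gamma>) *\<^sub>R d"] power2_norm_eq_inner)
  also have "\<dots> \<le> norm (- subgrad 0 - q) * norm d"
    by (rule norm_cauchy_schwarz)
  also have "\<dots> \<le> R / \<gamma> * norm d"
    using bound by (rule mult_right_mono) simp
  finally have "norm d * norm d \<le> R * norm d"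
    using gamma(1) by (simp add: field_simps power2_eq_square)
  moreover have "0 \<le> R / \<gamma>"
    using bound norm_ge_zero order_trans by blast
  then have "0 \<le> R"
    using gamma(1) by (simp add: zero_le_divide_iff)
  ultimately have near: "norm d \<le> R"
    by (cases "d = 0") auto
  then show "norm (x 1 - y) \<le> R"
    by (simp add: d_def)
  have "norm (transpose A *v (l 1 - l 0)) \<le> R / \<gamma> + norm ((1 / \<gamma>) *\<^sub>R d)"
    unfolding step using norm_triangle_ineq4 bound by (rule order_trans[OF _ add_right_mono])
  also have "\<dots> \<le> R / \<gamma> + R / \<gamma>"
    using near gamma(1) by (intro add_left_mono) (simp add: divide_right_mono)
  finally show "\<gamma> * norm (transpose A *v (l 1 - l 0)) \<le> 2 * R"
    using gamma(1) by (simp add: field_simps)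
qed

text \<open>
  The energy after one iteration is bounded by the data at iteration \<open>0\<close> whatever the penalties are.
  The penalty terms of the merit function are the only ones where \<open>\<beta>\<^sub>0\<close> and \<open>\<beta>\<^sub>1\<close> occur, and
  they are again dominated by \<open>\<alpha>\<^sub>0\<close> times the squared image of the dual step.
\<close>

lemma first_energy_le:
  assumes y: "A *v y = b" and M: "norm (subgrad 0) \<le> M"
    and R: "R = \<gamma> * (M + norm (grad h (x 0) + transpose A *v l 0 + (1 / \<gamma>) *\<^sub>R (y - z 0)))"
    and T: "T = R + norm (y - z 0)"
    and a: "0 \<le> a" "a \<le> \<alpha>" "limeal_alpha A \<gamma> \<eta> \<beta> 0 \<le> a" and c: "0 \<le> c"
    and L: "0 \<le> L"
  shows "merit 1 + c * a * (\<gamma>\<^sup>2 * L\<^sup>2 * (primal_step 0)\<^sup>2 + (prox_center_step 0)\<^sup>2)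
    \<le> h y + g y + (M + norm (grad h y) + norm (transpose A *v l 0)) * R + (\<rho> + L) / 2 * R\<^sup>2
      + 8 * \<alpha> * R\<^sup>2 + 1 / (2 * \<gamma>) * T\<^sup>2
      + c * \<alpha> * (\<gamma>\<^sup>2 * L\<^sup>2 * (R + norm (y - x 0))\<^sup>2 + \<eta>\<^sup>2 * T\<^sup>2)"
proof -
  note near = first_iterate_near_feasible[OF y M R]
  define d where "d = x 1 - y"
  define r where "r = A *v x 1 - b"
  have d: "norm d \<le> R" and "0 \<le> R"
    using near(1) norm_ge_zero order_trans unfolding d_def by blast+
  have d2: "(norm d)\<^sup>2 \<le> R\<^sup>2"
    using d by (intro power_mono) auto
  have \<rho>: "0 < \<rho>"
    using g_wc by (simp add: weakly_convex_def)
  have inner_le: "v \<bullet> d \<le> K * R" if "norm v \<le> K" for v K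
    using norm_cauchy_schwarz[of v d] mult_mono[OF that d order_trans[OF norm_ge_zero that]]
    by simp
  have "g (x 1) + subgrad 0 \<bullet> (y - x 1) - \<rho> / 2 * (norm (y - x 1))\<^sup>2 \<le> g y"
    using weak_subgradientD[OF subgrad_weak_subgradient[of 0]] by simp
  then have "g (x 1) \<le> g y + subgrad 0 \<bullet> d + \<rho> / 2 * (norm d)\<^sup>2"
    by (simp add: d_def norm_minus_commute inner_diff_right)
  moreover have "\<rho> / 2 * (norm d)\<^sup>2 \<le> \<rho> / 2 * R\<^sup>2"
    using d2 \<rho> by (intro mult_left_mono) auto
  ultimately have g_le: "g (x 1) \<le> g y + M * R + \<rho> / 2 * R\<^sup>2"
    using inner_le[OF M] by linarith
  have "h (x 1) \<le> h y + grad h y \<bullet> d + L / 2 * (norm d)\<^sup>2"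
    unfolding d_def by (rule lipschitz_gradient_upper_bound[OF h_grad h_lip])
  moreover have "L / 2 * (norm d)\<^sup>2 \<le> L / 2 * R\<^sup>2"
    using d2 L by (intro mult_left_mono) auto
  ultimately have h_le: "h (x 1) \<le> h y + norm (grad h y) * R + L / 2 * R\<^sup>2"
    using inner_le[OF order_refl, of "grad h y"] by linarith
  have "l 0 \<bullet> r = (transpose A *v l 0) \<bullet> d"
    unfolding matrix_transpose_inner by (simp add: r_def d_def y matrix_vector_mult_diff_distrib)
  then have l_le: "l 0 \<bullet> r \<le> norm (transpose A *v l 0) * R"
    using inner_le[OF order_refl, of "transpose A *v l 0"] by simp
  have penalty: "(\<beta> 0 + \<beta> 1 / 2) * (norm r)\<^sup>2 \<le> 8 * \<alpha> * R\<^sup>2"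
  proof -
    define \<kappa> where "\<kappa> = \<eta> * (1 - \<eta> / 2)"
    have dual: "(\<gamma> * norm (transpose A *v (l 1 - l 0)))\<^sup>2 \<le> (2 * R)\<^sup>2"
      using gamma(1) by (intro power_mono[OF near(2)]) simp
    have "0 \<le> \<gamma> * \<kappa>"
      using eta gamma(1) by (simp add: \<kappa>_def)
    then have "(\<beta> 0 + \<beta> 1 / 2) * (norm r)\<^sup>2 \<le> 2 * ((\<beta> 0 + \<beta> (Suc 0) + \<gamma> * \<kappa>) / 2 * (norm r)\<^sup>2)"
      using beta_pos[of "Suc 0"] mult_right_mono[of "\<beta> 0 + \<beta> 1 / 2" "\<beta> 0 + \<beta> (Suc 0) + \<gamma> * \<kappa>" "(norm r)\<^sup>2"]
      by simp
    also have "\<dots> \<le> 2 * (limeal_alpha A \<gamma> \<eta> \<beta> 0 * (\<gamma> * norm (transpose A *v (l 1 - l 0)))\<^sup>2)"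
      using infeasibility_le_dual_step[of 0] by (simp add: \<kappa>_def r_def)
    also have "\<dots> \<le> 2 * (\<alpha> * (2 * R)\<^sup>2)"
      using a dual by (intro mult_left_mono mult_mono) auto
    finally show ?thesis
      by (simp add: power_mult_distrib)
  qed
  have center: "norm (x 1 - z 0) \<le> T"
    using norm_triangle_ineq[of d "y - z 0"] d by (simp add: T d_def)
  have prox_term: "1 / (2 * \<gamma>) * (norm (x 1 - z 1))\<^sup>2 \<le> 1 / (2 * \<gamma>) * T\<^sup>2"
  proof -
    have "x 1 - z 1 = (1 - \<eta>) *\<^sub>R (x 1 - z 0)"
      using z_step[of 0] by (simp add: algebra_simps)
    then have "norm (x 1 - z 1) = \<bar>1 - \<eta>\<bar> * norm (x 1 - z 0)"
      by simp
    also have "\<dots> \<le> 1 * norm (x 1 - z 0)"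
      using eta by (intro mult_right_mono) auto
    finally show ?thesis
      using center gamma(1) by (intro mult_left_mono power_mono) auto
  qed
  have "merit 1 = h (x 1) + g (x 1) + l 0 \<bullet> r + (\<beta> 0 + \<beta> 1 / 2) * (norm r)\<^sup>2
      + 1 / (2 * \<gamma>) * (norm (x 1 - z 1))\<^sup>2"
    using l_step[of 0]
    unfolding merit_def prox_aug_lagrangian_def aug_lagrangian_def One_nat_def[symmetric] r_def[symmetric]
    by (simp add: inner_add_left power2_norm_eq_inner distrib_right)
  moreover have "c * a * (\<gamma>\<^sup>2 * L\<^sup>2 * (primal_step 0)\<^sup>2 + (prox_center_step 0)\<^sup>2)
      \<le> c * \<alpha> * (\<gamma>\<^sup>2 * L\<^sup>2 * (R + norm (y - x 0))\<^sup>2 + \<eta>\<^sup>2 * T\<^sup>2)"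
  proof -
    have "primal_step 0 \<le> R + norm (y - x 0)"
      using norm_triangle_ineq[of d "y - x 0"] d by (simp add: primal_step_def d_def)
    moreover have "prox_center_step 0 \<le> \<eta> * T"
      using center eta by (simp add: prox_center_step_def z_step norm_minus_commute)
    ultimately have "\<gamma>\<^sup>2 * L\<^sup>2 * (primal_step 0)\<^sup>2 + (prox_center_step 0)\<^sup>2
        \<le> \<gamma>\<^sup>2 * L\<^sup>2 * (R + norm (y - x 0))\<^sup>2 + (\<eta> * T)\<^sup>2"
      by (intro add_mono mult_left_mono power_mono)
        (auto simp: primal_step_def prox_center_step_def)
    then show ?thesis
      using a c by (intro mult_mono) (auto simp: power_mult_distrib)
  qed
  ultimately show ?thesis
    using g_le h_le l_le penalty prox_term by (simp add: ring_distribs add_divide_distrib)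
qed

lemma limeal_energy_eq:
  "limeal_energy c h g A b L \<gamma> \<eta> \<beta> x z l (Suc k) = merit (Suc k)
    + c * limeal_alpha A \<gamma> \<eta> \<beta> (Suc k) * (\<gamma>\<^sup>2 * L\<^sup>2 * (primal_step k)\<^sup>2 + (prox_center_step k)\<^sup>2)"
  by (simp add: limeal_energy_def merit_def primal_step_def prox_center_step_def)

lemma limeal_xi_eq: "limeal_xi h \<gamma> \<beta> x z l k = Min (residual ` {0..k})"
  by (simp add: limeal_xi_def residual_def[abs_def])

section \<open>Rates under the implicit subgradient properties\<close>

lemma dual_step_le_lipschitz:
  assumes "implicit_lipschitz_subgradient \<rho> g Lg"
  shows "(\<gamma> * norm (transpose A *v (l (Suc (Suc k)) - l (Suc k))))\<^sup>2
    \<le> 3 * ((1 + \<gamma> * Lg \<gamma>)\<^sup>2 * (primal_step (Suc k))\<^sup>2 + \<gamma>\<^sup>2 * L\<^sup>2 * (primal_step k)\<^sup>2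
      + (prox_center_step k)\<^sup>2 + 0)"
proof -
  have "norm (subgrad (Suc k) - subgrad k) \<le> Lg \<gamma> * primal_step (Suc k)"
    unfolding primal_step_def
    using assms g_wc gamma subgrad_weak_subgradient
    by (intro implicit_lipschitz_weak_subgradient) (auto simp: weakly_convex_def)
  then have "\<gamma> * norm (subgrad (Suc k) - subgrad k) \<le> \<gamma> * (Lg \<gamma> * primal_step (Suc k))"
    using gamma(1) by (intro mult_left_mono) auto
  then have "\<gamma> * norm (transpose A *v (l (Suc (Suc k)) - l (Suc k)))
      \<le> (1 + \<gamma> * Lg \<gamma>) * primal_step (Suc k) + \<gamma> * L * primal_step k + prox_center_step k"
    using dual_step_le[of k] by (simp add: algebra_simps)
  then have "(\<gamma> * norm (transpose A *v (l (Suc (Suc k)) - l (Suc k))))\<^sup>2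
      \<le> ((1 + \<gamma> * Lg \<gamma>) * primal_step (Suc k) + \<gamma> * L * primal_step k + prox_center_step k)\<^sup>2"
    using gamma(1) by (intro power_mono) auto
  also note power2_sum3_le
  finally show ?thesis
    by (simp add: power_mult_distrib)
qed

lemma subgrad_bounded:
  assumes "implicit_bounded_subgradient \<rho> g M"
  shows "norm (subgrad k) \<le> M \<gamma>"
  using assms g_wc gamma subgrad_weak_subgradient
  by (intro implicit_bounded_weak_subgradient) (auto simp: weakly_convex_def)

text \<open>
  Without Lipschitz control the difference of two subgradients only contributes a constant. It enters
  the descent multiplied by \<open>\<alpha>\<^sub>k\<close>, so with \<open>\<alpha>\<^sub>k\<close> of order \<open>1 / K\<close> its total over \<open>K\<close> iterations
  stays bounded.
\<close>

lemma dual_step_le_bounded: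
  assumes "implicit_bounded_subgradient \<rho> g M"
  shows "(\<gamma> * norm (transpose A *v (l (Suc (Suc k)) - l (Suc k))))\<^sup>2
    \<le> 4 * (1 * (primal_step (Suc k))\<^sup>2 + \<gamma>\<^sup>2 * L\<^sup>2 * (primal_step k)\<^sup>2
      + (prox_center_step k)\<^sup>2 + (2 * \<gamma> * M \<gamma>)\<^sup>2)"
proof -
  have "norm (subgrad (Suc k) - subgrad k) \<le> 2 * M \<gamma>"
    using norm_triangle_ineq4[of "subgrad (Suc k)" "subgrad k"] subgrad_bounded[OF assms, of k]
      subgrad_bounded[OF assms, of "Suc k"] by linarith
  then have "\<gamma> * norm (subgrad (Suc k) - subgrad k) \<le> \<gamma> * (2 * M \<gamma>)"
    using gamma(1) by (intro mult_left_mono) auto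
  then have "\<gamma> * norm (transpose A *v (l (Suc (Suc k)) - l (Suc k)))
      \<le> primal_step (Suc k) + \<gamma> * L * primal_step k + prox_center_step k + 2 * \<gamma> * M \<gamma>"
    using dual_step_le[of k] by simp
  then have "(\<gamma> * norm (transpose A *v (l (Suc (Suc k)) - l (Suc k))))\<^sup>2
      \<le> (primal_step (Suc k) + \<gamma> * L * primal_step k + prox_center_step k + 2 * \<gamma> * M \<gamma>)\<^sup>2"
    using gamma(1) by (intro power_mono) auto
  also note power2_sum4_le
  finally show ?thesis
    by (simp add: power_mult_distrib)
qed

lemma sum_residual_le:
  assumes dual: "\<And>k. (\<gamma> * norm (transpose A *v (l (Suc (Suc k)) - l (Suc k))))\<^sup>2
      \<le> c * (p * (primal_step (Suc k))\<^sup>2 + \<gamma>\<^sup>2 * L\<^sup>2 * (primal_step k)\<^sup>2 + (prox_center_step k)\<^sup>2 + \<omega>)"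
    and a: "0 \<le> a" "\<And>k. limeal_alpha A \<gamma> \<eta> \<beta> k \<le> a"
    and primal: "c * a * (p + \<gamma>\<^sup>2 * L\<^sup>2)
      \<le> (1 - \<gamma> * (\<rho> + L) - \<eta> * (1 - \<eta> / 2) * \<gamma>\<^sup>2 * L\<^sup>2) / (2 * \<gamma>)"
    and center: "c * a \<le> (2 / \<eta> - 1) / (4 * \<gamma>)"
    and lower: "\<And>k. e \<le> merit (Suc k)
      + c * a * (\<gamma>\<^sup>2 * L\<^sup>2 * (primal_step k)\<^sup>2 + (prox_center_step k)\<^sup>2)"
  shows "\<gamma> * (\<eta> * (1 - \<eta> / 2)) / 4 * (\<Sum>k = 1..n. (residual k)\<^sup>2)
    \<le> merit 1 + c * a * (\<gamma>\<^sup>2 * L\<^sup>2 * (primal_step 0)\<^sup>2 + (prox_center_step 0)\<^sup>2) - e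
      + real n * (c * a * \<omega>)"
proof -
  define E where "E k = merit k
    + c * a * (\<gamma>\<^sup>2 * L\<^sup>2 * (primal_step (k - 1))\<^sup>2 + (prox_center_step (k - 1))\<^sup>2)" for k
  have "\<gamma> * (\<eta> * (1 - \<eta> / 2)) / 4 * (\<Sum>k = 1..n. (residual k)\<^sup>2) \<le> E 1 - E (Suc n) + real n * (c * a * \<omega>)"
  proof (rule sum_le_of_descent)
    fix k :: nat
    assume "1 \<le> k"
    then obtain j where "k = Suc j"
      using Suc_le_D by auto
    then show "E (Suc k) + \<gamma> * (\<eta> * (1 - \<eta> / 2)) / 4 * (residual k)\<^sup>2 \<le> E k + c * a * \<omega>"
      using energy_descent[OF dual a primal center, of j] by (simp add: E_def)
  qed
  moreover have "e \<le> E (Suc n)"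
    using lower[of n] by (simp add: E_def)
  ultimately show ?thesis
    by (simp add: E_def)
qed

text \<open>
  Here the energy bounds the whole series. The upper bound \<open>a\<close> on \<open>\<alpha>\<^sub>k\<close> replaces \<open>\<alpha>\<^sub>k\<close> in the energy
  because \<open>\<alpha>\<^sub>k\<close> itself may be negative if \<open>A = 0\<close>.
\<close>

lemma summable_residual:
  assumes "implicit_lipschitz_subgradient \<rho> g Lg"
    and a: "0 \<le> a" "\<And>k. limeal_alpha A \<gamma> \<eta> \<beta> k \<le> a"
    and "3 * a * ((1 + \<gamma> * Lg \<gamma>)\<^sup>2 + \<gamma>\<^sup>2 * L\<^sup>2)
      \<le> (1 - \<gamma> * (\<rho> + L) - \<eta> * (1 - \<eta> / 2) * \<gamma>\<^sup>2 * L\<^sup>2) / (2 * \<gamma>)"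
    and "3 * a \<le> (2 / \<eta> - 1) / (4 * \<gamma>)"
    and lower: "\<And>k. e \<le> merit (Suc k)
      + 3 * a * (\<gamma>\<^sup>2 * L\<^sup>2 * (primal_step k)\<^sup>2 + (prox_center_step k)\<^sup>2)"
  shows "summable (\<lambda>k. (residual k)\<^sup>2)"
proof -
  define C where "C = \<gamma> * (\<eta> * (1 - \<eta> / 2)) / 4"
  define B where "B = merit 1
    + 3 * a * (\<gamma>\<^sup>2 * L\<^sup>2 * (primal_step 0)\<^sup>2 + (prox_center_step 0)\<^sup>2) - e"
  have C: "0 < C"
    using eta gamma(1) by (simp add: C_def)
  have "C * (\<Sum>k = 1..n. (residual k)\<^sup>2) \<le> B" for n
    using sum_residual_le[OF dual_step_le_lipschitz[OF assms(1)] assms(2-), of n]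
    by (simp add: B_def C_def)
  then have tail: "(\<Sum>k = 1..n. (residual k)\<^sup>2) \<le> B / C" for n
    using C by (simp add: field_simps)
  have "(\<Sum>k<n. (residual (Suc k))\<^sup>2) \<le> B / C" for n
    using tail[of n] by (simp add: sum.atLeast1_atMost_eq)
  then have "summable (\<lambda>k. (residual (Suc k))\<^sup>2)"
    by (intro summableI_nonneg_bounded) auto
  then show ?thesis
    using summable_Suc_iff[of "\<lambda>k. (residual k)\<^sup>2"] by simp
qed

end

text \<open>
  The bound on \<open>\<gamma>\<close> is the positive root of \<open>q \<gamma>\<^sup>2 + s \<gamma> = 1\<close>, in the form obtained by
  rationalising its numerator.
\<close>

lemma quadratic_less_one:
  fixes \<gamma> s q :: real
  assumes "0 < \<gamma>" and s: "0 < s" and q: "0 \<le> q"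
    and less: "\<gamma> < 2 / (s * (1 + sqrt (1 + 4 * q / s\<^sup>2)))"
  shows "\<gamma> * s + q * \<gamma>\<^sup>2 < 1"
proof -
  define w where "w = sqrt (1 + 4 * q / s\<^sup>2)"
  define u where "u = \<gamma> * s"
  have "1 \<le> w"
    using q by (simp add: w_def)
  have "w\<^sup>2 = 1 + 4 * q / s\<^sup>2"
    using q by (simp add: w_def)
  then have "q * \<gamma>\<^sup>2 = u * (u * (1 + w)) * ((w - 1) / 4)"
    using s by (simp add: u_def field_simps power2_eq_square)
  moreover have u: "0 < u" "u * (1 + w) < 2"
    using assms(1) s less[folded w_def] \<open>1 \<le> w\<close>
    by (simp_all add: u_def pos_less_divide_eq mult.assoc)
  moreover have "u * (u * (1 + w)) * ((w - 1) / 4) \<le> u * 2 * ((w - 1) / 4)"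
    using u \<open>1 \<le> w\<close> by (intro mult_right_mono mult_left_mono) auto
  moreover have "u * 2 * ((w - 1) / 4) = u * (1 + w) / 2 - u"
    by (simp add: field_simps)
  ultimately show ?thesis
    unfolding u_def[symmetric] by linarith
qed

theorem theorem3:
  fixes A :: "real^'n^'m" and b :: "real^'m"
    and h g :: "real^'n \<Rightarrow> real"
    and L\<^sub>h \<rho>\<^sub>g \<eta> \<gamma> :: real
  assumes feasible: "{x. A *v x = b} \<noteq> {}"
    and h_diff: "h differentiable_on UNIV"
    and Lh_pos: "0 < L\<^sub>h"
    and h_lip: "L\<^sub>h-lipschitz_on UNIV (grad h)"
    and g_lsc: "lower_semicont g"
    and g_wc: "weakly_convex \<rho>\<^sub>g g"
    and eta: "0 < \<eta>" "\<eta> < 2"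
    and gamma_pos: "0 < \<gamma>"
    and gamma_less: "\<gamma> < 2 / ((\<rho>\<^sub>g + L\<^sub>h) *
          (1 + sqrt (1 + 2 * (2 - \<eta>) * \<eta> * L\<^sub>h\<^sup>2 / (\<rho>\<^sub>g + L\<^sub>h)\<^sup>2)))"
  shows
    "(\<forall>(\<beta>::real) (L\<^sub>g :: real \<Rightarrow> real) x z l.
        limeal h g A b \<gamma> \<eta> (\<lambda>_. \<beta>) x z l \<and>
        (2 * \<beta> + \<gamma> * \<eta> * (1 - \<eta> / 2)) / (2 * c_const \<gamma> A * \<beta>\<^sup>2) <
          min (1 / (12 * \<gamma>) * (2 / \<eta> - 1))
              ((1 - \<gamma> * (\<rho>\<^sub>g + L\<^sub>h) - \<eta> * (1 - \<eta> / 2) * \<gamma>\<^sup>2 * L\<^sub>h\<^sup>2) /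
               (6 * \<gamma> * ((1 + \<gamma> * L\<^sub>g \<gamma>)\<^sup>2 + \<gamma>\<^sup>2 * L\<^sub>h\<^sup>2))) \<and>
        implicit_lipschitz_subgradient \<rho>\<^sub>g g L\<^sub>g \<and>
        bdd_below (limeal_energy 3 h g A b L\<^sub>h \<gamma> \<eta> (\<lambda>_. \<beta>) x z l ` {1..})
        \<longrightarrow> limeal_xi h \<gamma> (\<lambda>_. \<beta>) x z l \<in> o(\<lambda>k. 1 / sqrt (real k)))
     \<and>
     (\<forall>(\<alpha>\<^sub>b::real) (L'\<^sub>g :: real \<Rightarrow> real) (x\<^sub>0 :: real^'n) (z\<^sub>0 :: real^'n) (l\<^sub>0 :: real^'m) (e::real).
        0 < \<alpha>\<^sub>b \<and>
        \<alpha>\<^sub>b \<le> min ((1 - \<gamma> * (\<rho>\<^sub>g + L\<^sub>h) - \<eta> * (1 - \<eta> / 2) * \<gamma>\<^sup>2 * L\<^sub>h\<^sup>2) /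
                    (8 * \<gamma> * (1 + \<gamma>\<^sup>2 * L\<^sub>h\<^sup>2)))
                   (1 / (16 * \<gamma>) * (2 / \<eta> - 1)) \<and>
        implicit_bounded_subgradient \<rho>\<^sub>g g L'\<^sub>g
        \<longrightarrow> (\<exists>c\<^sub>3 > 0. \<forall>(K::nat) \<beta> x z l.
               1 \<le> K \<and>
               limeal h g A b \<gamma> \<eta> \<beta> x z l \<and> x 0 = x\<^sub>0 \<and> z 0 = z\<^sub>0 \<and> l 0 = l\<^sub>0 \<and>
               (\<forall>k. limeal_alpha A \<gamma> \<eta> \<beta> k = \<alpha>\<^sub>b / real K) \<and>
               (\<forall>k\<ge>1. e \<le> limeal_energy 4 h g A b L\<^sub>h \<gamma> \<eta> \<beta> x z l k)
               \<longrightarrow> limeal_xi h \<gamma> \<beta> x z l K \<le> c\<^sub>3 / sqrt (real K)))"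
proof -
  define D where "D = 1 - \<gamma> * (\<rho>\<^sub>g + L\<^sub>h) - \<eta> * (1 - \<eta> / 2) * \<gamma>\<^sup>2 * L\<^sub>h\<^sup>2"
  have rho: "0 < \<rho>\<^sub>g"
    using g_wc by (simp add: weakly_convex_def)
  have kappa: "0 < \<eta> * (1 - \<eta> / 2)"
    using eta by simp
  have "\<gamma> * (\<rho>\<^sub>g + L\<^sub>h) + (\<eta> * (1 - \<eta> / 2) * L\<^sub>h\<^sup>2) * \<gamma>\<^sup>2 < 1"
  proof (rule quadratic_less_one)
    have eq: "4 * (\<eta> * (1 - \<eta> / 2) * L\<^sub>h\<^sup>2) = 2 * (2 - \<eta>) * \<eta> * L\<^sub>h\<^sup>2"
      by (simp add: algebra_simps)
    show "\<gamma> < 2 / ((\<rho>\<^sub>g + L\<^sub>h) * (1 + sqrt (1 + 4 * (\<eta> * (1 - \<eta> / 2) * L\<^sub>h\<^sup>2) / (\<rho>\<^sub>g + L\<^sub>h)\<^sup>2)))"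
      unfolding eq by (rule gamma_less)
  qed (use gamma_pos rho Lh_pos kappa in auto)
  then have D: "0 < D"
    by (simp add: D_def algebra_simps)
  moreover have "0 < \<gamma> * L\<^sub>h" "0 \<le> \<eta> * (1 - \<eta> / 2) * \<gamma>\<^sup>2 * L\<^sub>h\<^sup>2"
    using gamma_pos Lh_pos kappa by auto
  ultimately have gamma_rho: "\<gamma> * \<rho>\<^sub>g < 1"
    by (simp add: D_def distrib_left)
  obtain y where y: "A *v y = b"
    using feasible by blast
  have grad_h: "GDERIV h u :> grad h u" for u
    using h_diff by (intro GDERIV_grad) (simp add: differentiable_on_def)
  have lip_h: "norm (grad h u - grad h v) \<le> L\<^sub>h * norm (u - v)" for u v
    using lipschitz_onD[OF h_lip, of u v] by (simp add: dist_norm)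
  have runI: "limeal_run A b h g L\<^sub>h \<rho>\<^sub>g \<eta> \<gamma> \<beta> x z l" if "limeal h g A b \<gamma> \<eta> \<beta> x z l" for \<beta> x z l
    using y grad_h lip_h g_wc eta gamma_pos gamma_rho that by unfold_locales auto

  show ?thesis
  proof (intro conjI allI impI; elim conjE)
    fix \<beta> :: real and Lg :: "real \<Rightarrow> real" and x z l
    let ?\<alpha> = "(2 * \<beta> + \<gamma> * \<eta> * (1 - \<eta> / 2)) / (2 * c_const \<gamma> A * \<beta>\<^sup>2)"
    assume limeal: "limeal h g A b \<gamma> \<eta> (\<lambda>_. \<beta>) x z l"
      and small: "?\<alpha> < min (1 / (12 * \<gamma>) * (2 / \<eta> - 1))
        ((1 - \<gamma> * (\<rho>\<^sub>g + L\<^sub>h) - \<eta> * (1 - \<eta> / 2) * \<gamma>\<^sup>2 * L\<^sub>h\<^sup>2)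
          / (6 * \<gamma> * ((1 + \<gamma> * Lg \<gamma>)\<^sup>2 + \<gamma>\<^sup>2 * L\<^sub>h\<^sup>2)))"
      and lip: "implicit_lipschitz_subgradient \<rho>\<^sub>g g Lg"
      and bdd: "bdd_below (limeal_energy 3 h g A b L\<^sub>h \<gamma> \<eta> (\<lambda>_. \<beta>) x z l ` {1..})"
    interpret limeal_run A b h g L\<^sub>h \<rho>\<^sub>g \<eta> \<gamma> "\<lambda>_. \<beta>" x z l
      by (rule runI[OF limeal])
    define P where "P = (1 + \<gamma> * Lg \<gamma>)\<^sup>2 + \<gamma>\<^sup>2 * L\<^sub>h\<^sup>2"
    define a where "a = max ?\<alpha> 0"
    have alpha: "limeal_alpha A \<gamma> \<eta> (\<lambda>_. \<beta>) k = ?\<alpha>" for k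
      by (simp add: limeal_alpha_def)
    have P: "0 < P"
      using gamma_pos Lh_pos by (simp add: P_def add_nonneg_pos)
    obtain e where e: "\<And>k. 1 \<le> k \<Longrightarrow> e \<le> limeal_energy 3 h g A b L\<^sub>h \<gamma> \<eta> (\<lambda>_. \<beta>) x z l k"
      using bdd unfolding bdd_below_def by auto
    have a_less: "a < 1 / (12 * \<gamma>) * (2 / \<eta> - 1)" "a < D / (6 * \<gamma> * P)"
      using small D P gamma_pos eta by (auto simp: a_def D_def[symmetric] P_def[symmetric])
    have "summable (\<lambda>k. (residual k)\<^sup>2)"
    proof (rule summable_residual[OF lip])
      show "0 \<le> a" "limeal_alpha A \<gamma> \<eta> (\<lambda>_. \<beta>) k \<le> a" for k
        by (simp_all add: alpha a_def)
      have "3 * a * P \<le> D / (2 * \<gamma>)"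
        using a_less(2) P gamma_pos by (simp add: field_simps)
      then show "3 * a * ((1 + \<gamma> * Lg \<gamma>)\<^sup>2 + \<gamma>\<^sup>2 * L\<^sub>h\<^sup>2)
          \<le> (1 - \<gamma> * (\<rho>\<^sub>g + L\<^sub>h) - \<eta> * (1 - \<eta> / 2) * \<gamma>\<^sup>2 * L\<^sub>h\<^sup>2) / (2 * \<gamma>)"
        unfolding P_def D_def .
      show "3 * a \<le> (2 / \<eta> - 1) / (4 * \<gamma>)"
        using a_less(1) gamma_pos by (simp add: field_simps)
      fix k
      let ?q = "\<gamma>\<^sup>2 * L\<^sub>h\<^sup>2 * (primal_step k)\<^sup>2 + (prox_center_step k)\<^sup>2"
      have "?\<alpha> \<le> a"
        by (simp add: a_def)
      then have "3 * ?\<alpha> * ?q \<le> 3 * a * ?q"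
        by (intro mult_right_mono mult_left_mono) simp_all
      then show "e \<le> merit (Suc k) + 3 * a * ?q"
        using e[of "Suc k"] by (simp add: limeal_energy_eq alpha)
    qed
    then have "(\<lambda>k. Min (residual ` {0..k})) \<in> o(\<lambda>k. 1 / sqrt (real k))"
      by (intro running_min_smallo) (simp add: residual_def)
    then show "limeal_xi h \<gamma> (\<lambda>_. \<beta>) x z l \<in> o(\<lambda>k. 1 / sqrt (real k))"
      by (simp add: limeal_xi_eq[abs_def])
  next
    fix \<alpha> :: real and M :: "real \<Rightarrow> real" and x0 z0 :: "real^'n" and l0 :: "real^'m" and e :: real
    assume alpha_pos: "0 < \<alpha>"
      and small: "\<alpha> \<le> min ((1 - \<gamma> * (\<rho>\<^sub>g + L\<^sub>h) - \<eta> * (1 - \<eta> / 2) * \<gamma>\<^sup>2 * L\<^sub>h\<^sup>2)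
          / (8 * \<gamma> * (1 + \<gamma>\<^sup>2 * L\<^sub>h\<^sup>2))) (1 / (16 * \<gamma>) * (2 / \<eta> - 1))"
      and bounded: "implicit_bounded_subgradient \<rho>\<^sub>g g M"
    \<comment> \<open>Everything below is fixed before \<open>K\<close>, the penalties and the run are chosen.\<close>
    define R where "R = \<gamma> * (M \<gamma> + norm (grad h x0 + transpose A *v l0 + (1 / \<gamma>) *\<^sub>R (y - z0)))"
    define T where "T = R + norm (y - z0)"
    define E1 where "E1 = h y + g y
      + (M \<gamma> + norm (grad h y) + norm (transpose A *v l0)) * R + (\<rho>\<^sub>g + L\<^sub>h) / 2 * R\<^sup>2
      + 8 * \<alpha> * R\<^sup>2 + 1 / (2 * \<gamma>) * T\<^sup>2
      + 4 * \<alpha> * (\<gamma>\<^sup>2 * L\<^sub>h\<^sup>2 * (R + norm (y - x0))\<^sup>2 + \<eta>\<^sup>2 * T\<^sup>2)"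
    define C where "C = \<gamma> * (\<eta> * (1 - \<eta> / 2)) / 4"
    define B where "B = (E1 - e + 4 * \<alpha> * (2 * \<gamma> * M \<gamma>)\<^sup>2) / C"
    have C: "0 < C"
      using kappa gamma_pos by (simp add: C_def)
    show "\<exists>c\<^sub>3 > 0. \<forall>(K::nat) \<beta> x z l.
        1 \<le> K \<and> limeal h g A b \<gamma> \<eta> \<beta> x z l \<and> x 0 = x0 \<and> z 0 = z0 \<and> l 0 = l0 \<and>
        (\<forall>k. limeal_alpha A \<gamma> \<eta> \<beta> k = \<alpha> / real K) \<and>
        (\<forall>k\<ge>1. e \<le> limeal_energy 4 h g A b L\<^sub>h \<gamma> \<eta> \<beta> x z l k)
        \<longrightarrow> limeal_xi h \<gamma> \<beta> x z l K \<le> c\<^sub>3 / sqrt (real K)"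
    \<comment> \<open>If no run meets the hypotheses, \<open>B\<close> may be negative; the constant has to be positive even then.\<close>
    proof (intro exI[of _ "sqrt \<bar>B\<bar> + 1"] conjI allI impI; (elim conjE)?)
      show "0 < sqrt \<bar>B\<bar> + 1"
        by (simp add: add_nonneg_pos)
      fix K :: nat and \<beta> x z l
      assume K: "1 \<le> K" and limeal: "limeal h g A b \<gamma> \<eta> \<beta> x z l"
        and init: "x 0 = x0" "z 0 = z0" "l 0 = l0"
        and alpha: "\<forall>k. limeal_alpha A \<gamma> \<eta> \<beta> k = \<alpha> / real K"
        and lower: "\<forall>k\<ge>1. e \<le> limeal_energy 4 h g A b L\<^sub>h \<gamma> \<eta> \<beta> x z l k"
      interpret limeal_run A b h g L\<^sub>h \<rho>\<^sub>g \<eta> \<gamma> \<beta> x z l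
        by (rule runI[OF limeal])
      define a where "a = \<alpha> / real K"
      have a: "0 \<le> a" "a \<le> \<alpha>" "limeal_alpha A \<gamma> \<eta> \<beta> k \<le> a" for k
        using alpha_pos K alpha by (auto simp: a_def field_simps)
      have "merit 1 + 4 * a * (\<gamma>\<^sup>2 * L\<^sub>h\<^sup>2 * (primal_step 0)\<^sup>2 + (prox_center_step 0)\<^sup>2) \<le> E1"
        unfolding E1_def init[symmetric]
        by (rule first_energy_le[OF y subgrad_bounded[OF bounded] _ _ a])
          (use Lh_pos in \<open>auto simp: R_def T_def init\<close>)
      moreover have "C * (\<Sum>k = 1..K. (residual k)\<^sup>2)
          \<le> merit 1 + 4 * a * (\<gamma>\<^sup>2 * L\<^sub>h\<^sup>2 * (primal_step 0)\<^sup>2 + (prox_center_step 0)\<^sup>2) - e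
            + real K * (4 * a * (2 * \<gamma> * M \<gamma>)\<^sup>2)"
        unfolding C_def
      proof (rule sum_residual_le[OF dual_step_le_bounded[OF bounded] a(1) a(3)])
        define Q where "Q = 1 + \<gamma>\<^sup>2 * L\<^sub>h\<^sup>2"
        have "0 < Q"
          by (simp add: Q_def add_pos_nonneg)
        moreover have "\<alpha> \<le> D / (8 * \<gamma> * Q)"
          using small by (simp add: D_def Q_def)
        ultimately have "4 * \<alpha> * (1 + \<gamma>\<^sup>2 * L\<^sub>h\<^sup>2) \<le> D / (2 * \<gamma>)"
          using gamma_pos unfolding Q_def[symmetric] by (simp add: field_simps)
        moreover have "4 * a * (1 + \<gamma>\<^sup>2 * L\<^sub>h\<^sup>2) \<le> 4 * \<alpha> * (1 + \<gamma>\<^sup>2 * L\<^sub>h\<^sup>2)"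
          using a(2) by (intro mult_right_mono) auto
        ultimately show "4 * a * (1 + \<gamma>\<^sup>2 * L\<^sub>h\<^sup>2)
            \<le> (1 - \<gamma> * (\<rho>\<^sub>g + L\<^sub>h) - \<eta> * (1 - \<eta> / 2) * \<gamma>\<^sup>2 * L\<^sub>h\<^sup>2) / (2 * \<gamma>)"
          unfolding D_def by linarith
        have "\<alpha> \<le> 1 / (16 * \<gamma>) * (2 / \<eta> - 1)"
          using small by simp
        moreover have "(2 / \<eta> - 1) / (4 * \<gamma>) = 4 * (1 / (16 * \<gamma>) * (2 / \<eta> - 1))"
          using gamma_pos by (simp add: field_simps)
        ultimately show "4 * a \<le> (2 / \<eta> - 1) / (4 * \<gamma>)"
          using a(2) by linarith
        show "e \<le> merit (Suc k) + 4 * a * (\<gamma>\<^sup>2 * L\<^sub>h\<^sup>2 * (primal_step k)\<^sup>2 + (prox_center_step k)\<^sup>2)" for k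
          using lower[rule_format, of "Suc k"] alpha by (simp add: limeal_energy_eq a_def)
      qed
      moreover have "real K * (4 * a * (2 * \<gamma> * M \<gamma>)\<^sup>2) = 4 * \<alpha> * (2 * \<gamma> * M \<gamma>)\<^sup>2"
        using K by (simp add: a_def)
      ultimately have "C * (\<Sum>k = 1..K. (residual k)\<^sup>2) \<le> E1 - e + 4 * \<alpha> * (2 * \<gamma> * M \<gamma>)\<^sup>2"
        by linarith
      then have "(\<Sum>k = 1..K. (residual k)\<^sup>2) \<le> B"
        using C by (simp add: B_def field_simps)
      then have "real K * (limeal_xi h \<gamma> \<beta> x z l K)\<^sup>2 \<le> B"
        using running_min_le[of residual 1 K B] K by (simp add: limeal_xi_eq residual_def)
      then have "(sqrt (real K) * limeal_xi h \<gamma> \<beta> x z l K)\<^sup>2 \<le> \<bar>B\<bar>"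
        by (simp add: power_mult_distrib)
      then have "sqrt (real K) * limeal_xi h \<gamma> \<beta> x z l K \<le> sqrt \<bar>B\<bar>"
        by (rule real_le_rsqrt)
      then show "limeal_xi h \<gamma> \<beta> x z l K \<le> (sqrt \<bar>B\<bar> + 1) / sqrt (real K)"
        using K by (simp add: pos_le_divide_eq mult.commute)
    qed
  qed
qed

end
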